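(* Let $(\mathcal A,(\mathcal A_t)_{t\ge 0},\mathbb E_{\mathcal A})$ and $(\mathcal B,(\mathcal B_t)_{t\ge 0},\mathbb E_{\mathcal B})$ be filtered $\mathrm W^*$-probability spaces, and let $X:\mathbb R_+\to L^2(\mathbb E_{\mathcal A})$ be an $L^2$-decomposable process. If $H:\mathbb R_+\to B(L^2(\mathbb E_{\mathcal A});L^2(\mathbb E_{\mathcal B}))$ is adapted and continuous (in operator norm) and $t\ge 0$, then the limit $$\int_0^t H(s)[dX(s)] := L^2\text{-}\lim_{|\Pi|\to 0}\ \sum_{s\in\Pi} H(s_-)[X(s)-X(s_-)]\in L^2(\mathcal B_t,\mathbb E_{\mathcal B})$$ over partitions $\Pi$ of $[0,t]$ exists. Moreover, the process $t\mapsto\int_0^t H(s)[dX(s)]$, $\mathbb R_+\to L^2(\mathbb E_{\mathcal B})$, is $L^2$-decomposable.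
   Context: A $\mathrm W^*$-probability space $(\mathcal A,\mathbb E)$ is a von Neumann algebra $\mathcal A$ with a faithful normal tracial state $\mathbb E$. For $p\in[1,\infty)$, $\|a\|_p=\mathbb E[|a|^p]^{1/p}$, and $L^p(\mathcal A,\mathbb E)=L^p(\mathbb E)$ is the $\|\cdot\|_p$-completion of $\mathcal A$; $L^\infty(\mathbb E)=\mathcal A$ with the operator norm. A filtration is an increasing family $(\mathcal A_t)_{t\ge0}$ of $\mathrm W^*$-subalgebras (unital, $\sigma$-weakly closed $*$-subalgebras). For a $\mathrm W^*$-subalgebra $\mathcal N$, $\mathbb E[\,\cdot\mid\mathcal N]:L^1(\mathcal A,\mathbb E)\to L^1(\mathcal N,\mathbb E)$ is the trace-preserving conditional expectation, which is contractive $L^p(\mathcal A,\mathbb E)\to L^p(\mathcal N,\mathbb E)$ for all $p$. All linear maps are real-linear; $B(V;W)$ is the space of bounded real-linear maps $V\to W$ with the operator norm. A process $X:\mathbb R_+\to L^p(\mathcal A,\mathbb E)$ is adapted if $X(t)\in L^p(\mathcal A_t,\mathbb E)$ for all $t$. It is an $L^p$-martingale if it is adapted and $\mathbb E[X(t)\mid\mathcal A_s]=X(s)$ for $0\le s\le t$. It is $L^p$-FV if it is adapted and has locally bounded variation with respect to $\|\cdot\|_p$. An $L^p$-decomposable process is an adapted process $X:\mathbb R_+\to L^p(\mathbb E)$ of the form $X=X(0)+M+A$ with $M$ an $L^p$-continuous $L^p$-martingale, $A$ an $L^p$-continuous $L^p$-FV process, and $M(0)=A(0)=0$. A map $H:\mathbb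 R_+\to B(L^2(\mathbb E_{\mathcal A});L^2(\mathbb E_{\mathcal B}))$ is adapted if $\mathbb E_{\mathcal B}[H(t)x\mid\mathcal B_u]=H(t)\,\mathbb E_{\mathcal A}[x\mid\mathcal A_u]$ for all $u\ge t\ge0$ and $x\in L^2(\mathbb E_{\mathcal A})$. A partition of $[0,t]$ is a finite set $\Pi=\{0=t_0<\cdots<t_n=t\}$; $s_-$ denotes the member of $\Pi$ immediately to the left of $s\in\Pi$ (with $0_-:=0$), and $|\Pi|=\max_{s\in\Pi}(s-s_-)$. *)

theory Defs
  imports "HOL-Analysis.Analysis"
begin

section \<open>Complex Hilbert spaces\<close>

text \<open>The underlying real Hilbert space is the library's; \<open>cinner\<close> is conjugate-linear in its
  first argument.\<close>

class complex_hilbert = real_inner + complete_space +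
  fixes scaleC :: "complex \<Rightarrow> 'a \<Rightarrow> 'a" (infixr "*\<^sub>C" 75)
    and cinner :: "'a \<Rightarrow> 'a \<Rightarrow> complex"
  assumes scaleC_add_right: "c *\<^sub>C (x + y) = c *\<^sub>C x + c *\<^sub>C y"
    and scaleC_add_left: "(c + d) *\<^sub>C x = c *\<^sub>C x + d *\<^sub>C x"
    and scaleC_scaleC: "c *\<^sub>C d *\<^sub>C x = (c * d) *\<^sub>C x"
    and scaleC_of_real: "of_real r *\<^sub>C x = r *\<^sub>R x"
    and cinner_commute: "cinner x y = cnj (cinner y x)"
    and cinner_add_right: "cinner x (y + z) = cinner x y + cinner x z"
    and cinner_scaleC_right: "cinner x (c *\<^sub>C y) = c * cinner x y"
    and inner_eq_Re_cinner: "inner x y = Re (cinner x y)"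

section \<open>Von Neumann algebras and tracial states\<close>

text \<open>Operators are elements of the type \<open>'h \<Rightarrow>\<^sub>L 'h\<close> of bounded real-linear maps;
  complex linearity is imposed separately.\<close>

definition complex_linear :: "('h::complex_hilbert \<Rightarrow>\<^sub>L 'h) \<Rightarrow> bool" where
  "complex_linear T \<longleftrightarrow> (\<forall>c x. T (c *\<^sub>C x) = c *\<^sub>C T x)"

definition scaleC_op :: "complex \<Rightarrow> ('h::complex_hilbert \<Rightarrow>\<^sub>L 'h) \<Rightarrow> ('h \<Rightarrow>\<^sub>L 'h)" where
  "scaleC_op c T = Blinfun (\<lambda>x. c *\<^sub>C T x)"

definition is_adjoint :: "('h::complex_hilbert \<Rightarrow>\<^sub>L 'h) \<Rightarrow> ('h \<Rightarrow>\<^sub>L 'h) \<Rightarrow> bool" where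
  "is_adjoint S T \<longleftrightarrow> (\<forall>x y. cinner (S x) y = cinner x (T y))"

definition adj :: "('h::complex_hilbert \<Rightarrow>\<^sub>L 'h) \<Rightarrow> ('h \<Rightarrow>\<^sub>L 'h)" where
  "adj T = (THE S. is_adjoint S T)"

definition sigma_weak_functionals :: "(('h::complex_hilbert \<Rightarrow>\<^sub>L 'h) \<Rightarrow> complex) set" where
  "sigma_weak_functionals =
     {(\<lambda>T :: 'h \<Rightarrow>\<^sub>L 'h. \<Sum>n. cinner (\<xi> n) (T (\<eta> n))) | \<xi> \<eta> :: nat \<Rightarrow> 'h.
        summable (\<lambda>n. (norm (\<xi> n))\<^sup>2) \<and> summable (\<lambda>n. (norm (\<eta> n))\<^sup>2)}"

definition sigma_weak_topology :: "('h::complex_hilbert \<Rightarrow>\<^sub>L 'h) topology" where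
  "sigma_weak_topology =
     topology_generated_by {\<phi> -` U | \<phi> U. \<phi> \<in> sigma_weak_functionals \<and> open U}"

definition von_neumann_algebra :: "('h::complex_hilbert \<Rightarrow>\<^sub>L 'h) set \<Rightarrow> bool" where
  "von_neumann_algebra A \<longleftrightarrow>
     (\<forall>a\<in>A. complex_linear a) \<and>
     id_blinfun \<in> A \<and>
     (\<forall>a\<in>A. \<forall>b\<in>A. a + b \<in> A) \<and>
     (\<forall>c. \<forall>a\<in>A. scaleC_op c a \<in> A) \<and>
     (\<forall>a\<in>A. \<forall>b\<in>A. a o\<^sub>L b \<in> A) \<and>
     (\<forall>a\<in>A. \<exists>b\<in>A. is_adjoint b a) \<and>
     closedin sigma_weak_topology A"

text \<open>A state is a function on all operators of which only the values on \<open>A\<close> matter.\<close>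

definition faithful_normal_tracial_state ::
    "('h::complex_hilbert \<Rightarrow>\<^sub>L 'h) set \<Rightarrow> (('h \<Rightarrow>\<^sub>L 'h) \<Rightarrow> complex) \<Rightarrow> bool" where
  "faithful_normal_tracial_state A E \<longleftrightarrow>
     (\<forall>a\<in>A. \<forall>b\<in>A. E (a + b) = E a + E b) \<and>
     (\<forall>c. \<forall>a\<in>A. E (scaleC_op c a) = c * E a) \<and>
     (\<forall>a\<in>A. E (adj a o\<^sub>L a) \<in> \<real>\<^sub>\<ge>\<^sub>0) \<and>
     E id_blinfun = 1 \<and>
     (\<forall>a\<in>A. E (adj a o\<^sub>L a) = 0 \<longrightarrow> a = 0) \<and>
     continuous_map (subtopology sigma_weak_topology A) euclidean E \<and>
     (\<forall>a\<in>A. \<forall>b\<in>A. E (a o\<^sub>L b) = E (b o\<^sub>L a))"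

definition Wstar_probability_space ::
    "('h::complex_hilbert \<Rightarrow>\<^sub>L 'h) set \<Rightarrow> (('h \<Rightarrow>\<^sub>L 'h) \<Rightarrow> complex) \<Rightarrow> bool" where
  "Wstar_probability_space A E \<longleftrightarrow>
     von_neumann_algebra A \<and> faithful_normal_tracial_state A E"

definition filtration ::
    "('h::complex_hilbert \<Rightarrow>\<^sub>L 'h) set \<Rightarrow> (real \<Rightarrow> ('h \<Rightarrow>\<^sub>L 'h) set) \<Rightarrow> bool" where
  "filtration A F \<longleftrightarrow>
     (\<forall>t\<ge>0. von_neumann_algebra (F t) \<and> F t \<subseteq> A) \<and>
     (\<forall>s t. 0 \<le> s \<and> s \<le> t \<longrightarrow> F s \<subseteq> F t)"

section \<open>The space $L^2$ and conditional expectations\<close>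

text \<open>The Hilbert space \<open>'l\<close> together with \<open>\<iota>\<close> is a completion of \<open>A\<close> with respect to
  \<open>\<parallel>a\<parallel>\<^sub>2 = E[a\<^sup>*a]\<^sup>1\<^sup>/\<^sup>2\<close>. As completions are unique up to unique isometric isomorphism over
  \<open>A\<close>, statements are made for an arbitrary one.\<close>

definition L2_completion ::
    "('h::complex_hilbert \<Rightarrow>\<^sub>L 'h) set \<Rightarrow> (('h \<Rightarrow>\<^sub>L 'h) \<Rightarrow> complex) \<Rightarrow>
     (('h \<Rightarrow>\<^sub>L 'h) \<Rightarrow> 'l::complex_hilbert) \<Rightarrow> bool" where
  "L2_completion A E \<iota> \<longleftrightarrow>
     (\<forall>a\<in>A. \<forall>b\<in>A. \<iota> (a + b) = \<iota> a + \<iota> b) \<and>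
     (\<forall>c. \<forall>a\<in>A. \<iota> (scaleC_op c a) = c *\<^sub>C \<iota> a) \<and>
     (\<forall>a\<in>A. \<forall>b\<in>A. cinner (\<iota> a) (\<iota> b) = E (adj a o\<^sub>L b)) \<and>
     closure (\<iota> ` A) = UNIV"

text \<open>$L^2(N, E)$ as a subspace of $L^2(A, E)$.\<close>

definition L2 :: "(('h::complex_hilbert \<Rightarrow>\<^sub>L 'h) \<Rightarrow> 'l::complex_hilbert) \<Rightarrow> ('h \<Rightarrow>\<^sub>L 'h) set \<Rightarrow> 'l set"
  where "L2 \<iota> N = closure (\<iota> ` N)"

text \<open>The number \<open>E[x b]\<close> for \<open>x\<close> in $L^2$ and \<open>b\<close> in the algebra: the continuous extension
  in \<open>x\<close> of \<open>a \<mapsto> E[a b] = E[b a] = cinner (\<iota> (b\<^sup>*)) (\<iota> a)\<close>.\<close>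

definition trace_mult ::
    "(('h::complex_hilbert \<Rightarrow>\<^sub>L 'h) \<Rightarrow> 'l::complex_hilbert) \<Rightarrow> 'l \<Rightarrow> ('h \<Rightarrow>\<^sub>L 'h) \<Rightarrow> complex" where
  "trace_mult \<iota> x b = cinner (\<iota> (adj b)) x"

text \<open>\<open>E[x | N]\<close> is the element of $L^2(N, E)$ with \<open>E[E[x | N] b] = E[x b]\<close> for all \<open>b \<in> N\<close>.
  Lemma \<open>cond_exp_eq_algebraic\<close> below shows that on the algebra it is the trace-preserving
  conditional expectation in the sense of operator algebras.\<close>

definition cond_exp ::
    "(('h::complex_hilbert \<Rightarrow>\<^sub>L 'h) \<Rightarrow> 'l::complex_hilbert) \<Rightarrow> ('h \<Rightarrow>\<^sub>L 'h) set \<Rightarrow> 'l \<Rightarrow> 'l" where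
  "cond_exp \<iota> N x = (THE y. y \<in> L2 \<iota> N \<and> (\<forall>b\<in>N. trace_mult \<iota> y b = trace_mult \<iota> x b))"

lemma is_adjoint_unique:
  assumes "is_adjoint S T" "is_adjoint S' T" shows "S = S'"
proof (rule blinfun_eqI)
  fix x
  have "cinner (S x) y = cinner (S' x) y" for y
    using assms unfolding is_adjoint_def by presburger
  then have "inner (S x) y = inner (S' x) y" for y
    by (simp only: inner_eq_Re_cinner)
  then show "S x = S' x"
    using vector_eq_rdot by blast
qed

lemma adj_eqI: "is_adjoint S T \<Longrightarrow> adj T = S"
  unfolding adj_def by (rule the_equality) (auto intro: is_adjoint_unique)

lemma is_adjoint_sym: "is_adjoint S T \<Longrightarrow> is_adjoint T S"
  unfolding is_adjoint_def
proof (intro allI)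
  fix x y assume *: "\<forall>x y. cinner (S x) y = cinner x (T y)"
  have "cinner (T x) y = cnj (cinner y (T x))" by (rule cinner_commute)
  also have "\<dots> = cnj (cinner (S y) x)" using * by simp
  also have "\<dots> = cinner x (S y)" by (rule cinner_commute[symmetric])
  finally show "cinner (T x) y = cinner x (S y)" .
qed

lemma von_neumann_algebra_adj:
  assumes "von_neumann_algebra A" "a \<in> A"
  shows "adj a \<in> A" "adj (adj a) = a"
proof -
  obtain b where b: "b \<in> A" "is_adjoint b a"
    using assms unfolding von_neumann_algebra_def by blast
  then have "adj a = b" "adj b = a"
    using adj_eqI is_adjoint_sym by blast+
  with b show "adj a \<in> A" "adj (adj a) = a" by auto
qed

lemma cond_exp_eqI:
  assumes N: "von_neumann_algebra N"
    and y: "y \<in> L2 \<iota> N" "\<And>b. b \<in> N \<Longrightarrow> trace_mult \<iota> y b = trace_mult \<iota> x b"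
  shows "cond_exp \<iota> N x = y"
  unfolding cond_exp_def
proof (rule the_equality)
  fix z
  assume z: "z \<in> L2 \<iota> N \<and> (\<forall>b\<in>N. trace_mult \<iota> z b = trace_mult \<iota> x b)"
  have *: "inner (\<iota> b) (z - y) = 0" if "b \<in> N" for b
  proof -
    have "trace_mult \<iota> z (adj b) = trace_mult \<iota> y (adj b)"
      using z y(2) von_neumann_algebra_adj(1)[OF N that] by presburger
    then have "cinner (\<iota> b) z = cinner (\<iota> b) y"
      by (simp only: trace_mult_def von_neumann_algebra_adj(2)[OF N that])
    then show ?thesis
      unfolding inner_diff_right by (simp only: inner_eq_Re_cinner diff_self)
  qed
  have "closure (\<iota> ` N) \<subseteq> {w. inner w (z - y) = 0}"
  proof (rule closure_minimal)
    show "\<iota> ` N \<subseteq> {w. inner w (z - y) = 0}" using * by auto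
    show "closed {w. inner w (z - y) = 0}"
      by (intro closed_Collect_eq continuous_intros)
  qed
  then have "inner z (z - y) = 0" "inner y (z - y) = 0"
    using conjunct1[OF z] y(1) unfolding L2_def by blast+
  then have "inner (z - y) (z - y) = 0"
    by (simp only: inner_diff_left)
  then show "z = y" by simp
next
  show "y \<in> L2 \<iota> N \<and> (\<forall>b\<in>N. trace_mult \<iota> y b = trace_mult \<iota> x b)"
    using y by blast
qed

lemma cond_exp_eq_algebraic:
  assumes W: "Wstar_probability_space A E" and \<iota>: "L2_completion A E \<iota>"
    and N: "von_neumann_algebra N" "N \<subseteq> A"
    and range: "\<And>a. a \<in> A \<Longrightarrow> \<Phi> a \<in> N"
    and module: "\<And>a b. a \<in> A \<Longrightarrow> b \<in> N \<Longrightarrow> \<Phi> (b o\<^sub>L a) = b o\<^sub>L \<Phi> a"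
    and trace: "\<And>a. a \<in> A \<Longrightarrow> E (\<Phi> a) = E a"
    and a: "a \<in> A"
  shows "cond_exp \<iota> N (\<iota> a) = \<iota> (\<Phi> a)"
proof (rule cond_exp_eqI[OF N(1)])
  have A: "von_neumann_algebra A" using W by (simp add: Wstar_probability_space_def)
  show "\<iota> (\<Phi> a) \<in> L2 \<iota> N"
    unfolding L2_def by (intro subsetD[OF closure_subset] imageI range a)
  show "trace_mult \<iota> (\<iota> (\<Phi> a)) b = trace_mult \<iota> (\<iota> a) b" if b: "b \<in> N" for b
  proof -
    have tr: "trace_mult \<iota> (\<iota> c) b = E (b o\<^sub>L c)" if "c \<in> A" for c
    proof -
      have "b \<in> A" using b N(2) by blast
      then have "adj b \<in> A" "adj (adj b) = b"
        using von_neumann_algebra_adj[OF A] by blast+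
      moreover from this(1) that have "cinner (\<iota> (adj b)) (\<iota> c) = E (adj (adj b) o\<^sub>L c)"
        using \<iota> unfolding L2_completion_def by blast
      ultimately show ?thesis by (simp only: trace_mult_def)
    qed
    have "b o\<^sub>L a \<in> A"
      using A a b N(2) unfolding von_neumann_algebra_def by blast
    then have "E (b o\<^sub>L \<Phi> a) = E (b o\<^sub>L a)"
      using trace[of "b o\<^sub>L a"] by (simp only: module[OF a b])
    moreover have "\<Phi> a \<in> A" using range[OF a] N(2) by blast
    ultimately show ?thesis by (simp only: tr a)
  qed
qed

section \<open>Partitions\<close>

definition partitions :: "real \<Rightarrow> real set set" where
  "partitions t = {P. finite P \<and> 0 \<in> P \<and> t \<in> P \<and> P \<subseteq> {0..t}}"

definition left_pt :: "real set \<Rightarrow> real \<Rightarrow> real" where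
  "left_pt P s = (if s = 0 then 0 else Max {r \<in> P. r < s})"

definition mesh :: "real set \<Rightarrow> real" where
  "mesh P = Max ((\<lambda>s. s - left_pt P s) ` P)"

definition mesh_to_0 :: "real \<Rightarrow> real set filter" where
  "mesh_to_0 t = inf (filtercomap mesh (nhds 0)) (principal (partitions t))"

definition locally_bounded_variation :: "(real \<Rightarrow> 'l::real_normed_vector) \<Rightarrow> bool" where
  "locally_bounded_variation X \<longleftrightarrow>
     (\<forall>t\<ge>0. \<exists>C. \<forall>P\<in>partitions t. (\<Sum>s\<in>P. norm (X s - X (left_pt P s))) \<le> C)"

section \<open>Processes\<close>

text \<open>Processes are indexed by the nonnegative reals; values at negative times are irrelevant.\<close>

definition adapted_process ::
    "(('h::complex_hilbert \<Rightarrow>\<^sub>L 'h) \<Rightarrow> 'l::complex_hilbert) \<Rightarrow> (real \<Rightarrow> ('h \<Rightarrow>\<^sub>L 'h) set) \<Rightarrow>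
     (real \<Rightarrow> 'l) \<Rightarrow> bool" where
  "adapted_process \<iota> F X \<longleftrightarrow> (\<forall>t\<ge>0. X t \<in> L2 \<iota> (F t))"

definition L2_martingale ::
    "(('h::complex_hilbert \<Rightarrow>\<^sub>L 'h) \<Rightarrow> 'l::complex_hilbert) \<Rightarrow> (real \<Rightarrow> ('h \<Rightarrow>\<^sub>L 'h) set) \<Rightarrow>
     (real \<Rightarrow> 'l) \<Rightarrow> bool" where
  "L2_martingale \<iota> F X \<longleftrightarrow> adapted_process \<iota> F X \<and>
     (\<forall>s t. 0 \<le> s \<and> s \<le> t \<longrightarrow> cond_exp \<iota> (F s) (X t) = X s)"

definition L2_FV ::
    "(('h::complex_hilbert \<Rightarrow>\<^sub>L 'h) \<Rightarrow> 'l::complex_hilbert) \<Rightarrow> (real \<Rightarrow> ('h \<Rightarrow>\<^sub>L 'h) set) \<Rightarrow>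
     (real \<Rightarrow> 'l) \<Rightarrow> bool" where
  "L2_FV \<iota> F X \<longleftrightarrow> adapted_process \<iota> F X \<and> locally_bounded_variation X"

definition L2_decomposable ::
    "(('h::complex_hilbert \<Rightarrow>\<^sub>L 'h) \<Rightarrow> 'l::complex_hilbert) \<Rightarrow> (real \<Rightarrow> ('h \<Rightarrow>\<^sub>L 'h) set) \<Rightarrow>
     (real \<Rightarrow> 'l) \<Rightarrow> bool" where
  "L2_decomposable \<iota> F X \<longleftrightarrow> adapted_process \<iota> F X \<and>
     (\<exists>M V. L2_martingale \<iota> F M \<and> continuous_on {0..} M \<and>
            L2_FV \<iota> F V \<and> continuous_on {0..} V \<and>
            M 0 = 0 \<and> V 0 = 0 \<and> (\<forall>t\<ge>0. X t = X 0 + M t + V t))"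

definition adapted_map ::
    "(('h::complex_hilbert \<Rightarrow>\<^sub>L 'h) \<Rightarrow> 'l::complex_hilbert) \<Rightarrow> (real \<Rightarrow> ('h \<Rightarrow>\<^sub>L 'h) set) \<Rightarrow>
     (('k::complex_hilbert \<Rightarrow>\<^sub>L 'k) \<Rightarrow> 'm::complex_hilbert) \<Rightarrow> (real \<Rightarrow> ('k \<Rightarrow>\<^sub>L 'k) set) \<Rightarrow>
     (real \<Rightarrow> 'l \<Rightarrow>\<^sub>L 'm) \<Rightarrow> bool" where
  "adapted_map \<iota> F \<kappa> G H \<longleftrightarrow>
     (\<forall>t u x. 0 \<le> t \<and> t \<le> u \<longrightarrow> cond_exp \<kappa> (G u) (H t x) = H t (cond_exp \<iota> (F u) x))"

section \<open>The stochastic integral\<close>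

definition integral_sum ::
    "(real \<Rightarrow> 'l::real_normed_vector \<Rightarrow>\<^sub>L 'm::real_normed_vector) \<Rightarrow> (real \<Rightarrow> 'l) \<Rightarrow> real set \<Rightarrow> 'm"
  where "integral_sum H X P = (\<Sum>s\<in>P. H (left_pt P s) (X s - X (left_pt P s)))"

definition stoch_integral ::
    "(real \<Rightarrow> 'l::real_normed_vector \<Rightarrow>\<^sub>L 'm::real_normed_vector) \<Rightarrow> (real \<Rightarrow> 'l) \<Rightarrow> real \<Rightarrow> 'm"
  where "stoch_integral H X t = Lim (mesh_to_0 t) (integral_sum H X)"

end

theory Submission
  imports Defs
begin

text \<open>
  On $L^2$ the conditional expectations are the orthogonal projections onto the closed subspaces
  \<open>L2 \<iota> (F t)\<close> (\<open>cond_exp_iff_orthogonal\<close>), so the statement is one about two Hilbert spaces,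
  each with an increasing family of closed subspaces: a martingale is an adapted process whose
  increments after time \<open>s\<close> are orthogonal to the subspace of time \<open>s\<close>, and an adapted \<open>H\<close> is one
  for which \<open>H t\<close> respects the subspaces of all times from \<open>t\<close> on, and their orthogonal
  complements.

  Let \<open>c\<close> be adapted and constant between the points of a partition, with operator norms at most
  \<open>C\<close>. Against a martingale \<open>M\<close>, the terms of the elementary integral of \<open>c\<close> are pairwise
  orthogonal, whence by Pythagoras its norm is at most \<open>C * norm (M t - M 0)\<close>
  (\<open>martingale_sum_bound\<close>). Against a process of finite variation, its norm is at most \<open>C\<close> times the
  variation (\<open>dominated_sum_bound\<close>). Either way the elementary integral is small if \<open>C\<close> is; this
  common property is called \<open>integrator\<close>.

  The difference of the Riemann sums over two fine partitions is the elementary integral, over the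
  common refinement, of a difference of values of \<open>H\<close> at nearby times. Uniform continuity of \<open>H\<close> on
  compact intervals makes it small (\<open>integral_sum_close\<close>), so the Riemann sums are Cauchy. The estimate
  is uniform in the upper end point of the integral, so the integral as a process is a locally uniform
  limit of Riemann sums of stopped processes. Continuity, the martingale property and the variation
  bound pass from these sums to the limit. The integral is additive in the integrator, so integrating
  the two parts of a decomposable process separately decomposes its integral.
\<close>

section \<open>Riemann sums over partitions\<close>

text \<open>Partitions without a prescribed right end point. Proofs about Riemann sums go by
  induction on the largest point, which changes the interval.\<close>

definition grid :: "real set \<Rightarrow> bool" where
  "grid Q \<longleftrightarrow> finite Q \<and> 0 \<in> Q \<and> Q \<subseteq> {0..}"

lemma partition_grid: "P \<in> partitions t \<Longrightarrow> grid P"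
  by (auto simp: partitions_def grid_def)

lemma partition_Max: "P \<in> partitions t \<Longrightarrow> Max P = t"
  by (auto simp: partitions_def intro!: Max_eqI)

lemma left_pt_in:
  assumes "grid Q" "0 < s"
  shows "left_pt Q s \<in> Q" "left_pt Q s < s"
proof -
  have "Max {r \<in> Q. r < s} \<in> {r \<in> Q. r < s}"
    using assms by (intro Max_in) (auto simp: grid_def)
  then show "left_pt Q s \<in> Q" "left_pt Q s < s"
    using assms(2) by (auto simp: left_pt_def)
qed

lemma left_pt_0 [simp]: "left_pt Q 0 = 0"
  by (simp add: left_pt_def)

lemma left_pt_mem: "grid Q \<Longrightarrow> 0 \<le> s \<Longrightarrow> left_pt Q s \<in> Q"
  using left_pt_in(1)[of Q s] by (cases "s = 0") (auto simp: grid_def)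

lemma left_pt_le: "grid Q \<Longrightarrow> 0 \<le> s \<Longrightarrow> left_pt Q s \<le> s"
  using left_pt_in(2)[of Q s] by (cases "s = 0") auto

lemma left_pt_nonneg: "grid Q \<Longrightarrow> 0 \<le> s \<Longrightarrow> 0 \<le> left_pt Q s"
  using left_pt_mem[of Q s] by (auto simp: grid_def)

lemma le_left_pt:
  assumes "grid Q" "r \<in> Q" "r < s" shows "r \<le> left_pt Q s"
proof -
  have "0 < s" using assms by (auto simp: grid_def)
  then show ?thesis using assms by (auto simp: left_pt_def grid_def)
qed

lemma left_pt_insert_greater: "s \<le> b \<Longrightarrow> left_pt (insert b Q) s = left_pt Q s"
proof -
  assume "s \<le> b"
  then have "{r \<in> insert b Q. r < s} = {r \<in> Q. r < s}" by auto
  then show ?thesis by (simp add: left_pt_def)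
qed

lemma grid_Max_less_iff: "grid Q \<Longrightarrow> Max Q < b \<longleftrightarrow> (\<forall>r\<in>Q. r < b)"
  by (subst Max_less_iff) (auto simp: grid_def)

lemma grid_insert_greatest:
  assumes "grid Q" "Max Q < b"
  shows "grid (insert b Q)" "Max (insert b Q) = b" "b \<notin> Q" "0 < b" "left_pt Q b = Max Q"
proof -
  have lt: "r < b" if "r \<in> Q" for r using assms that by (simp add: grid_Max_less_iff)
  then show b: "0 < b" using assms(1) by (simp add: grid_def)
  show "b \<notin> Q" using lt by blast
  show "grid (insert b Q)" using assms(1) b by (simp add: grid_def)
  show "Max (insert b Q) = b" using assms(1) lt by (intro Max_eqI) (auto simp: grid_def less_imp_le)
  have "{r \<in> Q. r < b} = Q" using lt by blast
  then show "left_pt Q b = Max Q" using b by (simp add: left_pt_def)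
qed

lemma grid_induct [consumes 1, case_names zero insert]:
  assumes "grid Q" and z: "R {0}"
    and ins: "\<And>b Q. grid Q \<Longrightarrow> Max Q < b \<Longrightarrow> R Q \<Longrightarrow> R (insert b Q)"
  shows "R Q"
proof -
  from assms(1) have "finite Q" by (simp add: grid_def)
  then have "0 \<in> Q \<and> Q \<subseteq> {0..} \<longrightarrow> R Q"
  proof (induction Q rule: finite_linorder_max_induct)
    case empty then show ?case by simp
  next
    case (insert b Q)
    show ?case
    proof (cases "Q = {}")
      case True then show ?thesis using z by auto
    next
      case False
      show ?thesis
      proof
        assume *: "0 \<in> insert b Q \<and> insert b Q \<subseteq> {0..}"
        with insert(2) False have "0 \<in> Q" by force
        with * insert(1) have "grid Q" by (simp add: grid_def)
        with insert * show "R (insert b Q)" by (intro ins) (auto simp: grid_Max_less_iff grid_def)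
      qed
    qed
  qed
  with assms(1) show ?thesis by (simp add: grid_def)
qed

text \<open>A new largest point leaves the left neighbours of all others alone, so it adds
  exactly one term. This drives all inductions over grids below.\<close>

lemma sum_insert_greatest:
  fixes f :: "real \<Rightarrow> real \<Rightarrow> 'a::comm_monoid_add"
  assumes "grid Q" "Max Q < b"
  shows "(\<Sum>s\<in>insert b Q. f s (left_pt (insert b Q) s)) = (\<Sum>s\<in>Q. f s (left_pt Q s)) + f b (Max Q)"
proof -
  have Q: "finite Q" "b \<notin> Q" "\<And>s. s \<in> Q \<Longrightarrow> s < b"
    using assms by (auto simp: grid_Max_less_iff grid_def)
  have "(\<Sum>s\<in>Q. f s (left_pt (insert b Q) s)) = (\<Sum>s\<in>Q. f s (left_pt Q s))"
    using Q(3) by (intro sum.cong) (auto simp: left_pt_insert_greater less_imp_le)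
  then show ?thesis
    using Q by (simp add: left_pt_insert_greater grid_insert_greatest[OF assms] add.commute)
qed

lemma sum_telescope:
  fixes w :: "real \<Rightarrow> 'a::ab_group_add"
  assumes "grid Q"
  shows "(\<Sum>s\<in>Q. w s - w (left_pt Q s)) = w (Max Q) - w 0"
  using assms
proof (induction rule: grid_induct)
  case (insert b Q)
  then show ?case
    using sum_insert_greatest[OF insert(1,2), of "\<lambda>s r. w s - w r"] insert(3)
    by (simp add: grid_insert_greatest(2)[OF insert(1,2)])
qed simp

text \<open>Since \<open>left_pt P\<close> is meaningful at every point of a refinement \<open>Q\<close>, a Riemann sum over
  \<open>P\<close> is also a sum over \<open>Q\<close> whose integrand is frozen at the points of \<open>P\<close>; two Riemann sums
  become comparable over a common refinement. The second summand corrects for the part of \<open>Q\<close>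
  to the right of \<open>P\<close>, where the frozen integrand is \<open>H (Max P)\<close>.\<close>

lemma integral_sum_refine:
  fixes H :: "real \<Rightarrow> 'a::real_normed_vector \<Rightarrow>\<^sub>L 'b::real_normed_vector"
  assumes "grid Q" "grid P" "P \<subseteq> Q"
  shows "(\<Sum>s\<in>Q. H (left_pt P s) (Y s - Y (left_pt Q s)))
     = integral_sum H Y P + H (Max P) (Y (Max Q) - Y (Max P))"
  using assms
proof (induction Q arbitrary: P rule: grid_induct)
  case zero
  then have "P = {0}" by (auto simp: grid_def)
  then show ?case by (simp add: integral_sum_def)
next
  case (insert b Q)
  have Q: "finite Q" "\<And>s. s \<in> Q \<Longrightarrow> s < b"
    using insert(1,2) by (auto simp: grid_Max_less_iff grid_def)
  note Qb = grid_insert_greatest[OF insert(1,2)]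
  have split: "(\<Sum>s\<in>insert b Q. H (left_pt P s) (Y s - Y (left_pt (insert b Q) s)))
     = (\<Sum>s\<in>Q. H (left_pt P s) (Y s - Y (left_pt Q s))) + H (left_pt P b) (Y b - Y (Max Q))"
    by (rule sum_insert_greatest[OF insert(1,2), of "\<lambda>s r. H (left_pt P s) (Y s - Y r)"])
  show ?case
  proof (cases "b \<in> P")
    case True
    define P' where "P' = P - {b}"
    have P': "P = insert b P'" "b \<notin> P'" "P' \<subseteq> Q" "grid P'"
      using True insert.prems Q Qb by (auto simp: P'_def grid_def)
    have lt: "Max P' < b" using P' Q(2) by (auto simp: grid_Max_less_iff)
    have "(\<Sum>s\<in>Q. H (left_pt P s) (Y s - Y (left_pt Q s)))
        = (\<Sum>s\<in>Q. H (left_pt P' s) (Y s - Y (left_pt Q s)))"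
      using Q(2) by (intro sum.cong) (auto simp: P'(1) left_pt_insert_greater less_imp_le)
    also have "\<dots> = integral_sum H Y P' + H (Max P') (Y (Max Q) - Y (Max P'))"
      by (rule insert(3)[OF P'(4,3)])
    finally have "(\<Sum>s\<in>insert b Q. H (left_pt P s) (Y s - Y (left_pt (insert b Q) s)))
       = integral_sum H Y P' + H (Max P') (Y b - Y (Max P'))"
      unfolding split using grid_insert_greatest(5)[OF P'(4) lt]
      by (simp add: P'(1) left_pt_insert_greater blinfun.diff_right)
    also have "\<dots> = integral_sum H Y P"
      unfolding integral_sum_def P'(1)
      by (rule sum_insert_greatest[OF P'(4) lt, of "\<lambda>s r. H r (Y s - Y r)", symmetric])
    finally show ?thesis
      using grid_insert_greatest(2)[OF P'(4) lt] Qb(2) by (simp add: P'(1))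
  next
    case False
    then have P: "P \<subseteq> Q" using insert.prems by auto
    then have "Max P < b" using Q(2) insert.prems by (auto simp: grid_Max_less_iff)
    then have "left_pt P b = Max P" by (rule grid_insert_greatest(5)[OF insert.prems(1)])
    then show ?thesis
      unfolding split insert(3)[OF insert.prems(1) P] Qb(2) by (simp add: blinfun.diff_right)
  qed
qed

text \<open>The mesh controls the gap to the left at all times, not only at partition points: the
  first partition point \<open>b \<ge> s\<close> has the same left neighbour as \<open>s\<close>.\<close>

lemma left_pt_near:
  assumes P: "P \<in> partitions t" and s: "0 \<le> s" "s \<le> t"
  shows "s - left_pt P s \<le> mesh P"
proof -
  have g: "grid P" using P by (rule partition_grid)
  define b where "b = Min {r \<in> P. s \<le> r}"
  have fin: "finite {r \<in> P. s \<le> r}" and ne: "{r \<in> P. s \<le> r} \<noteq> {}"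
    using P s by (auto simp: partitions_def)
  have b: "b \<in> P" "s \<le> b" using Min_in[OF fin ne] by (auto simp: b_def)
  have le: "b \<le> r" if "r \<in> P" "s \<le> r" for r unfolding b_def using fin that by (intro Min_le) auto
  have "left_pt P b \<le> left_pt P s"
  proof (cases "s = 0")
    case True
    then have "b = 0" using le[of 0] g b by (auto simp: grid_def)
    then show ?thesis using True by simp
  next
    case False
    then have "left_pt P b < s"
      using left_pt_in[OF g, of b] b s le[of "left_pt P b"] by force
    moreover have "left_pt P b \<in> P" using left_pt_mem[OF g] b s by simp
    ultimately show ?thesis by (intro le_left_pt[OF g])
  qed
  moreover have "b - left_pt P b \<le> mesh P"
    unfolding mesh_def using P b by (intro Max_ge) (auto simp: partitions_def)
  ultimately show ?thesis using b by linarith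
qed

lemma partition_exists:
  assumes "0 \<le> t" "0 < \<delta>"
  shows "\<exists>P\<in>partitions t. mesh P < \<delta>"
proof -
  obtain n :: nat where "t / \<delta> < real n"
    using reals_Archimedean2 by blast
  moreover have "0 \<le> t / \<delta>" using assms by simp
  ultimately have n: "0 < n" "t / \<delta> < real n" by auto
  define P where "P = (\<lambda>k::nat. t * real k / real n) ` {..n}"
  have "t * real k / real n \<le> t" if "k \<le> n" for k
    using assms n that by (simp add: divide_le_eq mult_left_mono)
  then have "P \<subseteq> {0..t}" using assms by (auto simp: P_def)
  moreover have "0 \<in> P" "t \<in> P"
    using n image_eqI[of 0 "\<lambda>k::nat. t * real k / real n" 0 "{..n}"]
      image_eqI[of t "\<lambda>k::nat. t * real k / real n" n "{..n}"] by (auto simp: P_def)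
  moreover have "finite P" by (simp add: P_def)
  ultimately have P: "P \<in> partitions t" by (simp add: partitions_def)
  have "s - left_pt P s < \<delta>" if "s \<in> P" for s
  proof (cases "s = 0")
    case True then show ?thesis using assms by simp
  next
    case False
    obtain j where j: "s = t * real j / real n" "j \<le> n"
      using \<open>s \<in> P\<close> unfolding P_def by blast
    with False obtain k where "j = Suc k" by (cases j) auto
    with j have k: "s = t * real (Suc k) / real n" "Suc k \<le> n" by auto
    have "t \<noteq> 0" using False k by auto
    then have "t * real k / real n < s"
      unfolding k(1) using assms n by (intro divide_strict_right_mono mult_strict_left_mono) auto
    moreover have "t * real k / real n \<in> P" using k(2) by (auto simp: P_def)
    ultimately have "t * real k / real n \<le> left_pt P s"
      by (intro le_left_pt[OF partition_grid[OF P]])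
    moreover have "s - t * real k / real n = t / real n"
      by (simp add: k(1) algebra_simps flip: diff_divide_distrib)
    moreover have "t / real n < \<delta>"
      using n assms by (simp add: pos_divide_less_eq mult.commute)
    ultimately show ?thesis by linarith
  qed
  then have "mesh P < \<delta>"
    unfolding mesh_def using P by (subst Max_less_iff) (auto simp: partitions_def)
  with P show ?thesis by blast
qed

lemma mesh_nonneg: "P \<in> partitions t \<Longrightarrow> 0 \<le> mesh P"
  using left_pt_near[of P t 0] by (auto simp: partitions_def)

lemma eventually_mesh_to_0I:
  assumes "0 < \<delta>" "\<And>P. P \<in> partitions t \<Longrightarrow> mesh P < \<delta> \<Longrightarrow> R P"
  shows "eventually R (mesh_to_0 t)"
proof -
  have "eventually (\<lambda>x::real. x < \<delta>) (nhds 0)"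
    using assms(1) by (rule order_tendstoD[OF filterlim_ident])
  then show ?thesis
    unfolding mesh_to_0_def eventually_inf_principal
    by (rule eventually_mono[OF eventually_filtercomapI]) (use assms(2) in auto)
qed

lemma mesh_to_0_nontrivial:
  assumes "0 \<le> t" shows "mesh_to_0 t \<noteq> bot"
proof
  assume "mesh_to_0 t = bot"
  then have "eventually (\<lambda>_. False) (mesh_to_0 t)" by simp
  then obtain R where R: "eventually R (nhds (0::real))" "\<And>P. R (mesh P) \<Longrightarrow> P \<notin> partitions t"
    unfolding mesh_to_0_def eventually_inf_principal eventually_filtercomap by auto
  then obtain \<delta> where \<delta>: "0 < \<delta>" "\<And>y. dist y 0 < \<delta> \<Longrightarrow> R y"
    unfolding eventually_nhds_metric by auto
  obtain P where P: "P \<in> partitions t" "mesh P < \<delta>"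
    using partition_exists[OF assms \<delta>(1)] by blast
  then have "R (mesh P)" using mesh_nonneg[OF P(1)] by (intro \<delta>(2)) (simp add: dist_real_def)
  with R(2) P(1) show False by blast
qed

section \<open>Elementary integrals in filtered Hilbert spaces\<close>

definition subspace_filtration :: "(real \<Rightarrow> 'a::real_inner set) \<Rightarrow> bool" where
  "subspace_filtration K \<longleftrightarrow>
     (\<forall>t\<ge>0. subspace (K t) \<and> closed (K t)) \<and> (\<forall>s t. 0 \<le> s \<longrightarrow> s \<le> t \<longrightarrow> K s \<subseteq> K t)"

text \<open>For closed subspaces of Hilbert spaces this says that \<open>T\<close> commutes with the orthogonal projections onto
  \<open>K u\<close> and \<open>L u\<close> for all \<open>u \<ge> a\<close>; the formulation by images avoids projections.\<close>

definition intertwines ::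
    "(real \<Rightarrow> 'a::real_inner set) \<Rightarrow> (real \<Rightarrow> 'b::real_inner set) \<Rightarrow> real \<Rightarrow> ('a \<Rightarrow>\<^sub>L 'b) \<Rightarrow> bool" where
  "intertwines K L a T \<longleftrightarrow> (\<forall>u\<ge>a. T ` K u \<subseteq> L u \<and> T ` ((K u)\<^sup>\<bottom>) \<subseteq> (L u)\<^sup>\<bottom>)"

definition martingale :: "(real \<Rightarrow> 'a::real_inner set) \<Rightarrow> (real \<Rightarrow> 'a) \<Rightarrow> bool" where
  "martingale K X \<longleftrightarrow>
     (\<forall>t\<ge>0. X t \<in> K t) \<and> (\<forall>s t. 0 \<le> s \<longrightarrow> s \<le> t \<longrightarrow> X t - X s \<in> (K s)\<^sup>\<bottom>)"

text \<open>The form in which finite variation is used. Bounds \<open>v t - v s\<close> telescope over a partition,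
  and they pass to stopped processes, which spares manipulating suprema over partitions.\<close>

definition dominates :: "(real \<Rightarrow> real) \<Rightarrow> (real \<Rightarrow> 'a::real_normed_vector) \<Rightarrow> bool" where
  "dominates v X \<longleftrightarrow> (\<forall>s t. 0 \<le> s \<longrightarrow> s \<le> t \<longrightarrow> norm (X t - X s) \<le> v t - v s)"

abbreviation stopped :: "real \<Rightarrow> (real \<Rightarrow> 'a) \<Rightarrow> real \<Rightarrow> 'a" where
  "stopped t X \<equiv> \<lambda>s. X (min s t)"

lemma in_orthogonal_comp: "x \<in> W\<^sup>\<bottom> \<longleftrightarrow> (\<forall>y\<in>W. inner y x = 0)"
  by (simp add: orthogonal_comp_def orthogonal_def)

lemma subspace_filtrationD:
  assumes "subspace_filtration K"
  shows "0 \<le> t \<Longrightarrow> subspace (K t)" "0 \<le> t \<Longrightarrow> closed (K t)" "0 \<le> s \<Longrightarrow> s \<le> t \<Longrightarrow> K s \<subseteq> K t"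
  using assms by (auto simp: subspace_filtration_def)

lemma intertwines_mono: "intertwines K L a T \<Longrightarrow> a \<le> b \<Longrightarrow> intertwines K L b T"
  by (auto simp: intertwines_def)

lemma intertwines_diff:
  assumes "subspace_filtration L" "0 \<le> a" "intertwines K L a S" "intertwines K L a T"
  shows "intertwines K L a (S - T)"
  using assms subspace_filtrationD(1)[OF assms(1)]
  by (auto simp: intertwines_def blinfun.diff_left image_subset_iff subspace_diff subspace_orthogonal_comp)

lemma intertwines_zero:
  assumes "subspace_filtration L" "0 \<le> a" shows "intertwines K L a 0"
  using assms subspace_filtrationD(1)[OF assms(1)]
  by (auto simp: intertwines_def subspace_0 subspace_orthogonal_comp)

lemma intertwines_id: "intertwines K K a id_blinfun"
  by (auto simp: intertwines_def)

lemma martingale_stopped: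
  assumes "subspace_filtration K" "martingale K X" "0 \<le> t"
  shows "martingale K (stopped t X)"
  unfolding martingale_def
proof (intro conjI allI impI)
  fix s :: real assume "0 \<le> s"
  then show "stopped t X s \<in> K s"
    using assms subspace_filtrationD(3)[OF assms(1), of "min s t" s] by (auto simp: martingale_def)
next
  fix s u :: real assume su: "0 \<le> s" "s \<le> u"
  show "stopped t X u - stopped t X s \<in> (K s)\<^sup>\<bottom>"
  proof (cases "s \<le> t")
    case True
    then have "min s t = s" "s \<le> min u t" using su by auto
    then show ?thesis using assms(2) su by (simp add: martingale_def)
  next
    case False
    then have "min s t = t" "min u t = t" using su by auto
    then show ?thesis by (simp add: subspace_0 subspace_orthogonal_comp)
  qed
qed

lemma martingale_increment:
  assumes K: "subspace_filtration K" and L: "subspace_filtration L" and X: "martingale K X"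
    and T: "intertwines K L a T" and a: "0 \<le> a" "a \<le> b"
  shows "T (X b - X a) \<in> L b" "T (X b - X a) \<in> (L a)\<^sup>\<bottom>"
proof -
  have "X a \<in> K b" "X b \<in> K b"
    using X a subspace_filtrationD(3)[OF K, of a b] by (auto simp: martingale_def)
  then have "X b - X a \<in> K b" using a by (intro subspace_diff subspace_filtrationD(1)[OF K]) auto
  then show "T (X b - X a) \<in> L b" using T a by (auto simp: intertwines_def)
  have "X b - X a \<in> (K a)\<^sup>\<bottom>" using X a by (auto simp: martingale_def)
  then show "T (X b - X a) \<in> (L a)\<^sup>\<bottom>"
    using T unfolding intertwines_def by blast
qed

text \<open>The analogue of the Ito isometry. If \<open>r < s\<close> are points of \<open>Q\<close>, then \<open>r \<le> left_pt Q s\<close>,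
  so the term at \<open>r\<close> lies in \<open>L (left_pt Q s)\<close>, while the term at \<open>s\<close> is orthogonal to that
  space.\<close>

lemma martingale_sum_Pythagorean:
  assumes K: "subspace_filtration K" and L: "subspace_filtration L" and X: "martingale K X"
    and Q: "grid Q" and c: "\<And>s. s \<in> Q \<Longrightarrow> intertwines K L (left_pt Q s) (c s)"
  shows "(norm (\<Sum>s\<in>Q. c s (X s - X (left_pt Q s))))\<^sup>2
       = (\<Sum>s\<in>Q. (norm (c s (X s - X (left_pt Q s))))\<^sup>2)"
proof (rule norm_sum_Pythagorean)
  show "finite Q" using Q by (simp add: grid_def)
  define z where "z s = c s (X s - X (left_pt Q s))" for s
  have nonneg: "0 \<le> s" if "s \<in> Q" for s using Q that by (auto simp: grid_def)
  have z: "z s \<in> L s" "z s \<in> (L (left_pt Q s))\<^sup>\<bottom>" if "s \<in> Q" for s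
    unfolding z_def
    using martingale_increment[OF K L X c[OF that]] left_pt_le[OF Q nonneg[OF that]]
      left_pt_nonneg[OF Q nonneg[OF that]] by auto
  have lt: "orthogonal (z r) (z s)" if "r \<in> Q" "s \<in> Q" "r < s" for r s
  proof -
    have "z r \<in> L (left_pt Q s)"
      using z(1)[OF that(1)] subspace_filtrationD(3)[OF L nonneg[OF that(1)] le_left_pt[OF Q that(1,3)]]
      by blast
    then show ?thesis using z(2)[OF that(2)] by (auto simp: orthogonal_comp_def)
  qed
  show "pairwise (\<lambda>i j. orthogonal (c i (X i - X (left_pt Q i))) (c j (X j - X (left_pt Q j)))) Q"
    unfolding pairwise_def z_def[symmetric]
    using lt by (metis linorder_neqE orthogonal_commute)
qed

lemma martingale_sum_bound:
  assumes K: "subspace_filtration K" and L: "subspace_filtration L" and X: "martingale K X"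
    and Q: "grid Q" and c: "\<And>s. s \<in> Q \<Longrightarrow> intertwines K L (left_pt Q s) (c s)"
    and C: "\<And>s. s \<in> Q \<Longrightarrow> norm (c s) \<le> C"
  shows "norm (\<Sum>s\<in>Q. c s (X s - X (left_pt Q s))) \<le> C * norm (X (Max Q) - X 0)"
proof (rule power2_le_imp_le)
  have "0 \<in> Q" using Q by (simp add: grid_def)
  then have C0: "0 \<le> C" using C norm_ge_zero order_trans by blast
  then show "0 \<le> C * norm (X (Max Q) - X 0)" by simp
  have "(norm (\<Sum>s\<in>Q. c s (X s - X (left_pt Q s))))\<^sup>2
      = (\<Sum>s\<in>Q. (norm (c s (X s - X (left_pt Q s))))\<^sup>2)"
    by (rule martingale_sum_Pythagorean[OF K L X Q c])
  also have "\<dots> \<le> (\<Sum>s\<in>Q. C\<^sup>2 * (norm (X s - X (left_pt Q s)))\<^sup>2)"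
  proof (rule sum_mono)
    fix s assume "s \<in> Q"
    then have "norm (c s (X s - X (left_pt Q s))) \<le> C * norm (X s - X (left_pt Q s))"
      by (intro order_trans[OF norm_blinfun] mult_right_mono C) auto
    then show "(norm (c s (X s - X (left_pt Q s))))\<^sup>2 \<le> C\<^sup>2 * (norm (X s - X (left_pt Q s)))\<^sup>2"
      by (metis norm_ge_zero power_mono power_mult_distrib)
  qed
  \<comment> \<open>The increments of \<open>X\<close> are the terms for the identity, so the same theorem adds them up again.\<close>
  also have "\<dots> = C\<^sup>2 * (\<Sum>s\<in>Q. (norm (id_blinfun (X s - X (left_pt Q s))))\<^sup>2)"
    by (simp add: sum_distrib_left)
  also have "\<dots> = C\<^sup>2 * (norm (\<Sum>s\<in>Q. id_blinfun (X s - X (left_pt Q s))))\<^sup>2"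
    by (subst martingale_sum_Pythagorean[OF K K X Q intertwines_id]) simp
  also have "\<dots> = (C * norm (X (Max Q) - X 0))\<^sup>2"
    using sum_telescope[OF Q, of X] by (simp add: power_mult_distrib)
  finally show "(norm (\<Sum>s\<in>Q. c s (X s - X (left_pt Q s))))\<^sup>2 \<le> (C * norm (X (Max Q) - X 0))\<^sup>2" .
qed

lemma martingale_norm_mono:
  assumes K: "subspace_filtration K" and X: "martingale K X" and st: "0 \<le> s" "s \<le> t"
  shows "norm (X s - X 0) \<le> norm (X t - X 0)"
proof -
  have "X s - X 0 \<in> K s"
    using martingale_increment(1)[OF K K X intertwines_id[of K 0], of s] st by simp
  moreover have "X t - X s \<in> (K s)\<^sup>\<bottom>" using X st by (auto simp: martingale_def)
  ultimately have "orthogonal (X s - X 0) (X t - X s)" by (auto simp: orthogonal_comp_def)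
  then have "(norm ((X s - X 0) + (X t - X s)))\<^sup>2 = (norm (X s - X 0))\<^sup>2 + (norm (X t - X s))\<^sup>2"
    by (rule norm_add_Pythagorean)
  then have "(norm (X s - X 0))\<^sup>2 \<le> (norm (X t - X 0))\<^sup>2" by simp
  then show ?thesis by (rule power2_le_imp_le) simp
qed

lemma dominated_sum_bound:
  fixes c :: "real \<Rightarrow> 'a::real_normed_vector \<Rightarrow>\<^sub>L 'b::real_normed_vector"
  assumes v: "dominates v X" and Q: "grid Q" and C: "\<And>s. s \<in> Q \<Longrightarrow> norm (c s) \<le> C"
  shows "(\<Sum>s\<in>Q. norm (c s (X s - X (left_pt Q s)))) \<le> C * (v (Max Q) - v 0)"
proof -
  have "0 \<in> Q" using Q by (simp add: grid_def)
  then have C0: "0 \<le> C" using C norm_ge_zero order_trans by blast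
  have "(\<Sum>s\<in>Q. norm (c s (X s - X (left_pt Q s)))) \<le> (\<Sum>s\<in>Q. C * (v s - v (left_pt Q s)))"
  proof (rule sum_mono)
    fix s assume s: "s \<in> Q"
    then have "0 \<le> s" using Q by (auto simp: grid_def)
    then have "norm (X s - X (left_pt Q s)) \<le> v s - v (left_pt Q s)"
      using v left_pt_nonneg[OF Q] left_pt_le[OF Q] by (auto simp: dominates_def)
    then show "norm (c s (X s - X (left_pt Q s))) \<le> C * (v s - v (left_pt Q s))"
      by (intro order_trans[OF norm_blinfun] mult_mono C s C0) auto
  qed
  also have "\<dots> = C * (v (Max Q) - v 0)"
    by (simp add: sum_telescope[OF Q] flip: sum_distrib_left)
  finally show ?thesis .
qed

text \<open>The process \<open>stopped t X - stopped s X\<close> moves only during \<open>[s, t]\<close>, where it moves like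
  \<open>X\<close>. It turns the increment of an integral over \<open>[s, t]\<close> into a Riemann sum over a partition
  of \<open>[0, t]\<close> that need not contain \<open>s\<close>.\<close>

lemma dominates_stopped_increment:
  assumes "dominates v X" "0 \<le> s" "s \<le> t"
  shows "dominates (\<lambda>r. v (min r t) - v (min r s)) (\<lambda>r. X (min r t) - X (min r s))"
  unfolding dominates_def
proof (intro allI impI)
  fix a b :: real assume ab: "0 \<le> a" "a \<le> b"
  consider "b \<le> s" | "a \<le> s" "s \<le> b" | "s \<le> a" by linarith
  then show "norm (X (min b t) - X (min b s) - (X (min a t) - X (min a s)))
      \<le> v (min b t) - v (min b s) - (v (min a t) - v (min a s))"
  proof cases
    case 1
    then have "min b t = b" "min b s = b" "min a t = a" "min a s = a" using ab assms by auto
    then show ?thesis by simp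
  next
    case 2
    then have "min b s = s" "min a t = a" "min a s = a" "s \<le> min b t" using ab assms by auto
    then show ?thesis using assms by (simp add: dominates_def)
  next
    case 3
    then have "min b s = s" "min a s = s" "min a t \<le> min b t" "0 \<le> min a t" using ab assms by auto
    then show ?thesis using assms by (simp add: dominates_def)
  qed
qed

text \<open>The variation function dominates: appending \<open>t\<close> to a partition of \<open>[0, s]\<close> gives a
  partition of \<open>[0, t]\<close> with variation larger by \<open>norm (X t - X s)\<close>.\<close>

lemma variation_dominates:
  assumes "locally_bounded_variation X"
  obtains v where "dominates v X"
proof
  define V where "V P = (\<Sum>s\<in>P. norm (X s - X (left_pt P s)))" for P
  define v where "v t = (SUP P\<in>partitions t. V P)" for t
  show "dominates v X"
    unfolding dominates_def
  proof (intro allI impI)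
    fix s t :: real assume st: "0 \<le> s" "s \<le> t"
    obtain C where C: "\<And>P. P \<in> partitions t \<Longrightarrow> V P \<le> C"
      using assms st unfolding locally_bounded_variation_def V_def by (meson order_trans)
    have bdd: "bdd_above (V ` partitions t)" by (rule bdd_aboveI2[OF C])
    show "norm (X t - X s) \<le> v t - v s"
    proof (cases "s = t")
      case False
      have "v s \<le> v t - norm (X t - X s)"
        unfolding v_def[of s]
      proof (rule cSUP_least)
        show "partitions s \<noteq> {}" using partition_exists[OF st(1), of 1] by auto
        fix P assume P: "P \<in> partitions s"
        then have g: "grid P" "Max P = s" by (auto simp: partition_grid partition_Max)
        have "insert t P \<in> partitions t" using P st by (auto simp: partitions_def)
        then have "V (insert t P) \<le> v t" unfolding v_def using bdd by (intro cSUP_upper)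
        moreover have "V (insert t P) = V P + norm (X t - X s)"
          unfolding V_def
          using sum_insert_greatest[OF g(1), of t "\<lambda>s r. norm (X s - X r)"] g(2) False st by simp
        ultimately show "V P \<le> v t - norm (X t - X s)" by simp
      qed
      then show ?thesis by simp
    qed simp
  qed
qed

section \<open>The integral of an adapted continuous integrand\<close>

text \<open>Elementary integrals of adapted operators of norm at most \<open>C\<close> are bounded by a multiple
  of \<open>C\<close>. Martingales and processes of finite variation share this property, and it is all that
  the construction of the integral uses. The bound is uniform in the stopping time \<open>t \<le> T\<close>, which
  makes the Riemann sums converge uniformly on \<open>[0, T]\<close>.\<close>

definition integrator ::
    "(real \<Rightarrow> 'a::real_inner set) \<Rightarrow> (real \<Rightarrow> 'b::real_inner set) \<Rightarrow> (real \<Rightarrow> 'a) \<Rightarrow> bool" where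
  "integrator K L X \<longleftrightarrow> (\<forall>T\<ge>0. \<exists>D. \<forall>Q c C. \<forall>t\<in>{0..T}. Q \<in> partitions T \<longrightarrow>
     (\<forall>s\<in>Q. intertwines K L (left_pt Q s) (c s) \<and> norm (c s) \<le> C) \<longrightarrow>
     norm (\<Sum>s\<in>Q. c s (stopped t X s - stopped t X (left_pt Q s))) \<le> C * D)"

lemma martingale_integrator:
  assumes K: "subspace_filtration K" and L: "subspace_filtration L" and X: "martingale K X"
  shows "integrator K L X"
  unfolding integrator_def
proof (intro allI impI exI ballI)
  fix T t C :: real and Q and c :: "real \<Rightarrow> 'a \<Rightarrow>\<^sub>L 'b"
  assume T: "0 \<le> T" and t: "t \<in> {0..T}" and Q: "Q \<in> partitions T"
    and c: "\<forall>s\<in>Q. intertwines K L (left_pt Q s) (c s) \<and> norm (c s) \<le> C"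
  have t0: "0 \<le> t" using t by simp
  have "norm (\<Sum>s\<in>Q. c s (stopped t X s - stopped t X (left_pt Q s)))
      \<le> C * norm (stopped t X (Max Q) - stopped t X 0)"
    using martingale_sum_bound[OF K L martingale_stopped[OF K X t0] partition_grid[OF Q], of c C] c
    by blast
  also have "\<dots> = C * norm (X t - X 0)" using t by (simp add: partition_Max[OF Q] min_absorb1 min_absorb2)
  also have "\<dots> \<le> C * norm (X T - X 0)"
  proof (rule mult_left_mono)
    show "norm (X t - X 0) \<le> norm (X T - X 0)" using martingale_norm_mono[OF K X] t by auto
    have "0 \<in> Q" using Q by (simp add: partitions_def)
    then show "0 \<le> C" using c norm_ge_zero order_trans by blast
  qed
  finally show "norm (\<Sum>s\<in>Q. c s (stopped t X s - stopped t X (left_pt Q s))) \<le> C * norm (X T - X 0)" .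
qed

lemma dominated_integrator:
  assumes v: "dominates v X"
  shows "integrator K L X"
  unfolding integrator_def
proof (intro allI impI exI ballI)
  fix T t C :: real and Q and c :: "real \<Rightarrow> 'a \<Rightarrow>\<^sub>L 'b"
  assume T: "0 \<le> T" and t: "t \<in> {0..T}" and Q: "Q \<in> partitions T"
    and c: "\<forall>s\<in>Q. intertwines K L (left_pt Q s) (c s) \<and> norm (c s) \<le> C"
  have stop: "dominates (stopped t v) (stopped t X)"
    using v t by (simp add: dominates_def)
  have "norm (\<Sum>s\<in>Q. c s (stopped t X s - stopped t X (left_pt Q s)))
      \<le> (\<Sum>s\<in>Q. norm (c s (stopped t X s - stopped t X (left_pt Q s))))"
    by (rule norm_sum)
  also have "\<dots> \<le> C * (stopped t v (Max Q) - stopped t v 0)"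
    using dominated_sum_bound[OF stop partition_grid[OF Q], of c C] c by blast
  also have "\<dots> = C * (v t - v 0)" using t by (simp add: partition_Max[OF Q] min_absorb1 min_absorb2)
  also have "\<dots> \<le> C * (v T - v 0)"
  proof (intro mult_left_mono diff_right_mono)
    have "norm (X T - X t) \<le> v T - v t" using v t by (auto simp: dominates_def)
    then show "v t \<le> v T" using norm_ge_zero[of "X T - X t"] by linarith
    have "0 \<in> Q" using Q by (simp add: partitions_def)
    then show "0 \<le> C" using c norm_ge_zero order_trans by blast
  qed
  finally show "norm (\<Sum>s\<in>Q. c s (stopped t X s - stopped t X (left_pt Q s))) \<le> C * (v T - v 0)" .
qed

lemma integral_sum_stopped:
  assumes "P \<in> partitions t" shows "integral_sum H (stopped t X) P = integral_sum H X P"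
  unfolding integral_sum_def
proof (rule sum.cong)
  fix s assume "s \<in> P"
  then have "0 \<le> s" "s \<le> t" using assms by (auto simp: partitions_def)
  then have "min s t = s" "min (left_pt P s) t = left_pt P s"
    using left_pt_le[OF partition_grid[OF assms], of s] by auto
  then show "H (left_pt P s) (stopped t X s - stopped t X (left_pt P s))
      = H (left_pt P s) (X s - X (left_pt P s))" by simp
qed simp

lemma integral_sum_diff:
  "integral_sum H X P - integral_sum H Y P = integral_sum H (\<lambda>s. X s - Y s) P"
  unfolding integral_sum_def sum_subtractf[symmetric]
  by (intro sum.cong) (simp_all flip: blinfun.diff_right add: algebra_simps)

lemma left_pt_subset_mono:
  assumes "grid P" "grid Q" "P \<subseteq> Q" "0 \<le> s" shows "left_pt P s \<le> left_pt Q s"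
proof (cases "s = 0")
  case False
  then show ?thesis
    using assms left_pt_in[OF assms(1), of s] by (intro le_left_pt) auto
qed simp

locale adapted_integrand =
  fixes K :: "real \<Rightarrow> 'a::real_inner set"
    and L :: "real \<Rightarrow> 'b::{real_inner,complete_space} set"
    and H :: "real \<Rightarrow> 'a \<Rightarrow>\<^sub>L 'b"
  assumes K: "subspace_filtration K" and L: "subspace_filtration L"
    and H_intertwines: "0 \<le> t \<Longrightarrow> intertwines K L t (H t)"
    and H_continuous: "continuous_on {0..} H"
begin

lemma H_bounded:
  obtains C where "\<And>t. 0 \<le> t \<Longrightarrow> t \<le> T \<Longrightarrow> norm (H t) \<le> C"
proof -
  have "compact (H ` {0..T})"
    using H_continuous by (intro compact_continuous_image) (auto intro: continuous_on_subset)
  then obtain C where "\<forall>x\<in>H ` {0..T}. norm x \<le> C"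
    using compact_imp_bounded bounded_iff by metis
  then show thesis by (intro that) auto
qed

text \<open>Over the common refinement \<open>Q\<close> of \<open>P\<close> and \<open>P'\<close> the difference is an elementary integral of
  the operators \<open>H (left_pt P s) - H (left_pt P' s)\<close>, which are small by uniform continuity of
  \<open>H\<close> and intertwine from time \<open>left_pt Q s\<close> on. Allowing partitions of two different intervals
  yields the Cauchy property (for \<open>t = T\<close>) and the uniform approximation at once.\<close>

lemma integral_sum_close:
  assumes X: "integrator K L X" and T: "0 \<le> T" and \<epsilon>: "0 < \<epsilon>"
  obtains \<delta> where "0 < \<delta>"
    "\<And>t P P'. t \<in> {0..T} \<Longrightarrow> P \<in> partitions T \<Longrightarrow> P' \<in> partitions t \<Longrightarrow> mesh P < \<delta> \<Longrightarrow> mesh P' < \<delta> \<Longrightarrow>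
       norm (integral_sum H (stopped t X) P - integral_sum H X P') \<le> \<epsilon>"
proof -
  obtain D where D: "\<And>Q c C t. t \<in> {0..T} \<Longrightarrow> Q \<in> partitions T \<Longrightarrow>
     \<forall>s\<in>Q. intertwines K L (left_pt Q s) (c s) \<and> norm (c s) \<le> C \<Longrightarrow>
     norm (\<Sum>s\<in>Q. c s (stopped t X s - stopped t X (left_pt Q s))) \<le> C * D"
    using X T unfolding integrator_def by meson
  define \<eta> where "\<eta> = \<epsilon> / (\<bar>D\<bar> + 1)"
  have \<eta>: "0 < \<eta>" using \<epsilon> by (simp add: \<eta>_def)
  have "\<eta> * D \<le> \<eta> * (\<bar>D\<bar> + 1)" using \<eta> by (intro mult_left_mono) auto
  then have \<eta>D: "\<eta> * D \<le> \<epsilon>" by (simp add: \<eta>_def)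
  have "uniformly_continuous_on {0..T} H"
    using H_continuous by (intro compact_uniformly_continuous) (auto intro: continuous_on_subset)
  then obtain \<delta> where \<delta>: "0 < \<delta>"
    "\<And>r s. r \<in> {0..T} \<Longrightarrow> s \<in> {0..T} \<Longrightarrow> dist r s < \<delta> \<Longrightarrow> dist (H r) (H s) < \<eta>"
    unfolding uniformly_continuous_on_def using \<eta> by metis
  show thesis
  proof (rule that[OF \<delta>(1)])
    fix t P P'
    assume t: "t \<in> {0..T}" and P: "P \<in> partitions T" "mesh P < \<delta>"
      and P': "P' \<in> partitions t" "mesh P' < \<delta>"
    define Q where "Q = P \<union> P'"
    have Q: "Q \<in> partitions T" using P P' t by (auto simp: Q_def partitions_def)
    have PQ: "P \<subseteq> Q" "P' \<subseteq> Q" by (auto simp: Q_def)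
    note g = partition_grid[OF P(1)] partition_grid[OF P'(1)] partition_grid[OF Q]
    define Y where "Y = stopped t X"
    \<comment> \<open>To the right of \<open>t\<close> the operators need not be close, but there the stopped process is constant.\<close>
    define c where
      "c s = (if left_pt Q s < t then H (left_pt P s) - H (left_pt P' s) else 0)" for s
    have c: "intertwines K L (left_pt Q s) (c s) \<and> norm (c s) \<le> \<eta>" if s: "s \<in> Q" for s
    proof -
      have sT: "0 \<le> s" "s \<le> T" using s Q by (auto simp: partitions_def)
      note le = left_pt_subset_mono[OF g(1,3) _ sT(1)] left_pt_subset_mono[OF g(2,3) _ sT(1)]
      note nonneg = left_pt_nonneg[OF g(1) sT(1)] left_pt_nonneg[OF g(2) sT(1)] left_pt_nonneg[OF g(3) sT(1)]
      have "intertwines K L (left_pt Q s) (c s)"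
        unfolding c_def
        using intertwines_mono[OF H_intertwines[OF nonneg(1)] le(1)]
          intertwines_mono[OF H_intertwines[OF nonneg(2)] le(2)]
        by (simp add: PQ intertwines_diff[OF L nonneg(3)] intertwines_zero[OF L nonneg(3)])
      moreover have "norm (c s) \<le> \<eta>"
      proof (cases "left_pt Q s < t")
        case True
        have "s \<le> t"
        proof (rule ccontr)
          assume "\<not> s \<le> t"
          then have "t \<le> left_pt Q s"
            using P'(1) by (intro le_left_pt[OF g(3)]) (auto simp: Q_def partitions_def)
          with True show False by simp
        qed
        then have "s - left_pt P s < \<delta>" "s - left_pt P' s < \<delta>"
          using left_pt_near[OF P(1) sT] left_pt_near[OF P'(1) sT(1)] P P' by auto
        then have "dist (left_pt P s) (left_pt P' s) < \<delta>"
          using left_pt_le[OF g(1) sT(1)] left_pt_le[OF g(2) sT(1)] by (auto simp: dist_real_def)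
        then have "dist (H (left_pt P s)) (H (left_pt P' s)) < \<eta>"
          using nonneg sT left_pt_le[OF g(1) sT(1)] left_pt_le[OF g(2) sT(1)] by (intro \<delta>(2)) auto
        then show ?thesis using True by (simp add: c_def dist_norm)
      next
        case False
        then show ?thesis using \<eta> by (simp add: c_def)
      qed
      ultimately show ?thesis ..
    qed
    have YT: "Y (Max Q) = Y t" using partition_Max[OF Q] t by (simp add: Y_def)
    have "integral_sum H Y P - integral_sum H Y P'
        = (\<Sum>s\<in>Q. H (left_pt P s) (Y s - Y (left_pt Q s)))
          - (\<Sum>s\<in>Q. H (left_pt P' s) (Y s - Y (left_pt Q s)))"
      using integral_sum_refine[OF g(3,1), of H Y] integral_sum_refine[OF g(3,2), of H Y] YT
      by (simp add: PQ partition_Max[OF P(1)] partition_Max[OF P'(1)] partition_Max[OF Q])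
    also have "\<dots> = (\<Sum>s\<in>Q. c s (Y s - Y (left_pt Q s)))"
      unfolding sum_subtractf[symmetric]
    proof (rule sum.cong)
      fix s assume "s \<in> Q"
      then have "left_pt Q s \<le> s" using g(3) by (intro left_pt_le) (auto simp: grid_def)
      then have "Y s = Y (left_pt Q s)" if "t \<le> left_pt Q s"
        using that by (simp add: Y_def min_absorb2)
      then show "H (left_pt P s) (Y s - Y (left_pt Q s)) - H (left_pt P' s) (Y s - Y (left_pt Q s))
          = c s (Y s - Y (left_pt Q s))"
        by (auto simp: c_def blinfun.diff_left)
    qed simp
    finally have "norm (integral_sum H Y P - integral_sum H Y P') \<le> \<eta> * D"
      using D[OF t Q, of c \<eta>] c by (simp add: Y_def)
    then show "norm (integral_sum H (stopped t X) P - integral_sum H X P') \<le> \<epsilon>"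
      using \<eta>D integral_sum_stopped[OF P'(1), of H X] by (simp add: Y_def)
  qed
qed

lemma integral_sum_tendsto:
  assumes X: "integrator K L X" and t: "0 \<le> t"
  shows "(integral_sum H X \<longlongrightarrow> stoch_integral H X t) (mesh_to_0 t)"
proof -
  have "cauchy_filter (filtermap (integral_sum H X) (mesh_to_0 t))"
    unfolding cauchy_filter_metric_filtermap
  proof (intro allI impI)
    fix e :: real assume "0 < e"
    then have "0 < e/2" by simp
    from integral_sum_close[OF X t this] obtain \<delta> where \<delta>: "0 < \<delta>"
      "\<And>u P P'. u \<in> {0..t} \<Longrightarrow> P \<in> partitions t \<Longrightarrow> P' \<in> partitions u \<Longrightarrow> mesh P < \<delta> \<Longrightarrow> mesh P' < \<delta> \<Longrightarrow>
         norm (integral_sum H (stopped u X) P - integral_sum H X P') \<le> e/2"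
      by blast
    have "dist (integral_sum H X P) (integral_sum H X P') < e"
      if "P \<in> partitions t \<and> mesh P < \<delta>" "P' \<in> partitions t \<and> mesh P' < \<delta>" for P P'
      using \<delta>(2)[of t P P'] that t \<open>0 < e\<close> integral_sum_stopped[of P t H X] by (simp add: dist_norm)
    moreover have "eventually (\<lambda>P. P \<in> partitions t \<and> mesh P < \<delta>) (mesh_to_0 t)"
      by (rule eventually_mesh_to_0I[OF \<delta>(1)]) simp
    ultimately show "\<exists>R. eventually R (mesh_to_0 t) \<and>
        (\<forall>P P'. R P \<and> R P' \<longrightarrow> dist (integral_sum H X P) (integral_sum H X P') < e)"
      by blast
  qed
  moreover have "complete (UNIV :: 'b set)"
    by (meson Cauchy_convergent UNIV_I complete_def convergent_def)
  moreover have "filtermap (integral_sum H X) (mesh_to_0 t) \<noteq> bot"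
    using mesh_to_0_nontrivial[OF t] by (simp add: filtermap_bot_iff)
  ultimately obtain l where "filtermap (integral_sum H X) (mesh_to_0 t) \<le> nhds l"
    unfolding complete_uniform by auto
  then have "(integral_sum H X \<longlongrightarrow> l) (mesh_to_0 t)" by (simp add: filterlim_def)
  moreover from this have "stoch_integral H X t = l"
    unfolding stoch_integral_def by (rule tendsto_Lim[OF mesh_to_0_nontrivial[OF t]])
  ultimately show ?thesis by simp
qed

text \<open>The Riemann sums of the stopped processes over one partition of \<open>[0, T]\<close> approximate the
  integrals up to all times \<open>t \<le> T\<close> simultaneously. The path properties of the integral are
  inherited from these approximations.\<close>

lemma stoch_integral_approx:
  assumes X: "integrator K L X" and T: "0 \<le> T"
  obtains P where "\<And>n::nat. P n \<in> partitions T"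
    "uniform_limit {0..T} (\<lambda>n t. integral_sum H (stopped t X) (P n)) (stoch_integral H X) sequentially"
proof -
  have "\<exists>P\<in>partitions T. \<forall>t\<in>{0..T}. norm (integral_sum H (stopped t X) P - stoch_integral H X t) \<le> \<epsilon>"
    if \<epsilon>: "0 < \<epsilon>" for \<epsilon>
  proof -
    obtain \<delta> where \<delta>: "0 < \<delta>"
      "\<And>t P P'. t \<in> {0..T} \<Longrightarrow> P \<in> partitions T \<Longrightarrow> P' \<in> partitions t \<Longrightarrow> mesh P < \<delta> \<Longrightarrow> mesh P' < \<delta> \<Longrightarrow>
         norm (integral_sum H (stopped t X) P - integral_sum H X P') \<le> \<epsilon>"
      using integral_sum_close[OF X T \<epsilon>] by blast
    obtain P where P: "P \<in> partitions T" "mesh P < \<delta>" using partition_exists[OF T \<delta>(1)] by blast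
    have "norm (integral_sum H (stopped t X) P - stoch_integral H X t) \<le> \<epsilon>" if t: "t \<in> {0..T}" for t
    proof (rule tendsto_upperbound)
      have t0: "0 \<le> t" using t by simp
      show "((\<lambda>P'. norm (integral_sum H (stopped t X) P - integral_sum H X P'))
          \<longlongrightarrow> norm (integral_sum H (stopped t X) P - stoch_integral H X t)) (mesh_to_0 t)"
        by (intro tendsto_intros integral_sum_tendsto[OF X t0])
      show "eventually (\<lambda>P'. norm (integral_sum H (stopped t X) P - integral_sum H X P') \<le> \<epsilon>) (mesh_to_0 t)"
        by (rule eventually_mesh_to_0I[OF \<delta>(1)]) (rule \<delta>(2)[OF t P(1) _ P(2)])
      show "\<not> trivial_limit (mesh_to_0 t)" by (rule mesh_to_0_nontrivial[OF t0])
    qed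
    with P show ?thesis by blast
  qed
  then have "\<forall>n. \<exists>P. P \<in> partitions T \<and>
      (\<forall>t\<in>{0..T}. norm (integral_sum H (stopped t X) P - stoch_integral H X t) \<le> inverse (real (Suc n)))"
    by (intro allI) (simp add: Bex_def)
  then obtain P where P: "\<And>n. P n \<in> partitions T"
    "\<And>n t. t \<in> {0..T} \<Longrightarrow> norm (integral_sum H (stopped t X) (P n) - stoch_integral H X t) \<le> inverse (real (Suc n))"
    by metis
  show thesis
  proof (rule that[OF P(1)], rule uniform_limitI)
    fix e :: real assume "0 < e"
    then have "eventually (\<lambda>n. inverse (real (Suc n)) < e) sequentially"
      by (rule order_tendstoD[OF LIMSEQ_inverse_real_of_nat])
    then show "\<forall>\<^sub>F n in sequentially. \<forall>t\<in>{0..T}.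
        dist (integral_sum H (stopped t X) (P n)) (stoch_integral H X t) < e"
      by (rule eventually_mono) (auto simp: dist_norm intro: le_less_trans[OF P(2)])
  qed
qed

lemma stoch_integral_at_0:
  assumes X: "integrator K L X" shows "stoch_integral H X 0 = 0"
proof -
  have "integral_sum H X P = 0" if "P \<in> partitions 0" for P
  proof -
    have "P = {0}" using that by (auto simp: partitions_def)
    then show ?thesis by (simp add: integral_sum_def)
  qed
  then have "eventually (\<lambda>P. integral_sum H X P = 0) (mesh_to_0 0)"
    by (intro eventually_mesh_to_0I[of 1]) auto
  then have "(integral_sum H X \<longlongrightarrow> 0) (mesh_to_0 0)" by (rule tendsto_eventually)
  then show ?thesis
    using tendsto_unique[OF mesh_to_0_nontrivial integral_sum_tendsto[OF X]] by simp
qed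

lemma stoch_integral_mem:
  assumes X: "integrator K L X" and adapted: "\<And>s. 0 \<le> s \<Longrightarrow> X s \<in> K s" and t: "0 \<le> t"
  shows "stoch_integral H X t \<in> L t"
proof (rule Lim_in_closed_set[OF subspace_filtrationD(2)[OF L t] _ mesh_to_0_nontrivial[OF t]
      integral_sum_tendsto[OF X t]])
  have "integral_sum H X P \<in> L t" if P: "P \<in> partitions t" for P
    unfolding integral_sum_def
  proof (rule subspace_sum[OF subspace_filtrationD(1)[OF L t]])
    fix s assume "s \<in> P"
    then have s: "0 \<le> s" "s \<le> t" using P by (auto simp: partitions_def)
    note l = left_pt_nonneg[OF partition_grid[OF P] s(1)] left_pt_le[OF partition_grid[OF P] s(1)]
    have "X s \<in> K t" "X (left_pt P s) \<in> K t"
      using adapted l s subspace_filtrationD(3)[OF K _ s(2)]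
        subspace_filtrationD(3)[OF K l(1), of t] by force+
    then have "X s - X (left_pt P s) \<in> K t" by (intro subspace_diff subspace_filtrationD(1)[OF K t])
    moreover have "left_pt P s \<le> t" using l s by simp
    ultimately show "H (left_pt P s) (X s - X (left_pt P s)) \<in> L t"
      using H_intertwines[OF l(1)] unfolding intertwines_def by blast
  qed
  then show "eventually (\<lambda>P. integral_sum H X P \<in> L t) (mesh_to_0 t)"
    by (intro eventually_mesh_to_0I[of 1]) auto
qed

text \<open>A uniform limit of continuous functions. The argument serves martingales and processes of
  finite variation alike, and avoids the continuity of the variation function.\<close>

lemma stoch_integral_continuous:
  assumes X: "integrator K L X" and cont: "continuous_on {0..} X"
  shows "continuous_on {0..} (stoch_integral H X)"
proof -
  have T: "continuous_on {0..T} (stoch_integral H X)" if T: "0 \<le> T" for T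
  proof -
    obtain P where P: "\<And>n::nat. P n \<in> partitions T"
      "uniform_limit {0..T} (\<lambda>n t. integral_sum H (stopped t X) (P n)) (stoch_integral H X) sequentially"
      using stoch_integral_approx[OF X T] by blast
    have "continuous_on {0..T} (\<lambda>t. integral_sum H (stopped t X) (P n))" for n
      unfolding integral_sum_def
    proof (intro continuous_intros continuous_on_compose2[OF cont])
      fix s assume "s \<in> P n"
      then have "0 \<le> s" using P(1)[of n] by (auto simp: partitions_def)
      then show "(\<lambda>t. min s t) ` {0..T} \<subseteq> {0..}" "(\<lambda>t. min (left_pt (P n) s) t) ` {0..T} \<subseteq> {0..}"
        using left_pt_nonneg[OF partition_grid[OF P(1)[of n]], of s] by auto
    qed
    then show ?thesis by (intro uniform_limit_theorem[OF _ P(2)]) auto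
  qed
  show ?thesis
    unfolding continuous_on_eq_continuous_within
  proof
    fix t :: real assume "t \<in> {0..}"
    then have "continuous (at t within {0..t + 1}) (stoch_integral H X)"
      using T[of "t + 1"] by (auto simp: continuous_on_eq_continuous_within)
    moreover have "at t within {0..t + 1} = at t within {0..}"
      by (rule at_within_nhd[of t "{..<t + 1}"]) auto
    ultimately show "continuous (at t within {0..}) (stoch_integral H X)" by simp
  qed
qed

lemma stoch_integral_increment:
  assumes X: "integrator K L X" and st: "0 \<le> s" "s \<le> t"
  obtains P where "\<And>n::nat. P n \<in> partitions t"
    "(\<lambda>n. integral_sum H (\<lambda>r. X (min r t) - X (min r s)) (P n))
       \<longlonglongrightarrow> stoch_integral H X t - stoch_integral H X s"
proof -
  have t: "0 \<le> t" using st by simp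
  obtain P where P: "\<And>n::nat. P n \<in> partitions t"
    "uniform_limit {0..t} (\<lambda>n r. integral_sum H (stopped r X) (P n)) (stoch_integral H X) sequentially"
    using stoch_integral_approx[OF X t] by blast
  have "(\<lambda>n. integral_sum H (stopped t X) (P n) - integral_sum H (stopped s X) (P n))
       \<longlonglongrightarrow> stoch_integral H X t - stoch_integral H X s"
    using st by (intro tendsto_diff tendsto_uniform_limitI[OF P(2)]) auto
  then show thesis using that[OF P(1)] by (simp add: integral_sum_diff)
qed

text \<open>Increments of the integral over \<open>[s, t]\<close> are limits of sums of terms
  \<open>H a (Y b - Y a)\<close> with \<open>Y = stopped t X - stopped s X\<close>. Each term is orthogonal to \<open>L s\<close>: an
  increment of \<open>X\<close> after time \<open>s\<close> is orthogonal to \<open>K s\<close>, and one after time \<open>a\<close> to \<open>K a\<close>;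
  the later of the two times is one from which \<open>H a\<close> intertwines.\<close>

lemma stoch_integral_martingale:
  assumes X: "martingale K X"
  shows "martingale L (stoch_integral H X)"
proof -
  note int = martingale_integrator[OF K L X]
  show ?thesis
    unfolding martingale_def
  proof (intro conjI allI impI)
    fix t :: real assume "0 \<le> t"
    then show "stoch_integral H X t \<in> L t"
      using X by (intro stoch_integral_mem[OF int]) (auto simp: martingale_def)
  next
    fix s t :: real assume st: "0 \<le> s" "s \<le> t"
    define Y where "Y r = X (min r t) - X (min r s)" for r
    have incr: "H a (Y b - Y a) \<in> (L s)\<^sup>\<bottom>" if ab: "0 \<le> a" "a \<le> b" for a b
    proof (cases "a \<le> s")
      case True
      define d where "d = max s (min b t)"
      have "Y b - Y a = X d - X s" "s \<le> d"
        using True st ab by (auto simp: Y_def d_def min_def max_def)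
      then show ?thesis
        using martingale_increment(2)[OF K L X intertwines_mono[OF H_intertwines[OF ab(1)] True], of d] st
        by simp
    next
      case False
      define a' b' where "a' = min a t" and "b' = min b t"
      have ab': "Y b - Y a = X b' - X a'" "s \<le> a'" "a' \<le> b'"
        using False st ab by (auto simp: Y_def a'_def b'_def min_def)
      show ?thesis
      proof (cases "a \<le> t")
        case True
        then have "a' = a" by (simp add: a'_def)
        then have "H a (Y b - Y a) \<in> (L a)\<^sup>\<bottom>"
          using martingale_increment(2)[OF K L X H_intertwines[OF ab(1)] ab(1), of b'] ab' by simp
        then show ?thesis
          using orthogonal_comp_anti_mono[OF subspace_filtrationD(3)[OF L st(1), of a]] False by auto
      next
        case False
        then have "a' = b'" using ab by (simp add: a'_def b'_def)
        then show ?thesis using ab' by (simp add: subspace_0 subspace_orthogonal_comp)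
      qed
    qed
    obtain P where P: "\<And>n::nat. P n \<in> partitions t"
      "(\<lambda>n. integral_sum H Y (P n)) \<longlonglongrightarrow> stoch_integral H X t - stoch_integral H X s"
      using stoch_integral_increment[OF int st] unfolding Y_def by blast
    have sum: "integral_sum H Y (P n) \<in> (L s)\<^sup>\<bottom>" for n
      unfolding integral_sum_def
    proof (rule subspace_sum[OF subspace_orthogonal_comp])
      fix r assume "r \<in> P n"
      then have "0 \<le> r" using P(1)[of n] by (auto simp: partitions_def)
      then show "H (left_pt (P n) r) (Y r - Y (left_pt (P n) r)) \<in> (L s)\<^sup>\<bottom>"
        using partition_grid[OF P(1)[of n]] by (intro incr left_pt_nonneg left_pt_le)
    qed
    show "stoch_integral H X t - stoch_integral H X s \<in> (L s)\<^sup>\<bottom>"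
      unfolding in_orthogonal_comp
    proof
      fix y assume "y \<in> L s"
      then have "inner y (integral_sum H Y (P n)) = 0" for n
        using sum[of n] by (simp add: in_orthogonal_comp)
      moreover have "(\<lambda>n. inner y (integral_sum H Y (P n)))
          \<longlonglongrightarrow> inner y (stoch_integral H X t - stoch_integral H X s)"
        by (intro tendsto_intros P(2))
      ultimately show "inner y (stoch_integral H X t - stoch_integral H X s) = 0"
        by (simp add: LIMSEQ_const_iff)
    qed
  qed
qed

text \<open>With \<open>C\<close> a bound of \<open>H\<close> on \<open>[0, T]\<close>, the integral is dominated on \<open>[0, T]\<close> by \<open>C\<close> times
  the function that dominates the integrator.\<close>

lemma stoch_integral_bounded_variation:
  assumes v: "dominates v X"
  shows "locally_bounded_variation (stoch_integral H X)"
  unfolding locally_bounded_variation_def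
proof (intro allI impI)
  fix T :: real assume T: "0 \<le> T"
  obtain C where C: "\<And>t. 0 \<le> t \<Longrightarrow> t \<le> T \<Longrightarrow> norm (H t) \<le> C" using H_bounded by blast
  have incr: "norm (stoch_integral H X t - stoch_integral H X s) \<le> C * (v t - v s)"
    if st: "0 \<le> s" "s \<le> t" "t \<le> T" for s t
  proof -
    define Y where "Y = (\<lambda>r. X (min r t) - X (min r s))"
    define w where "w = (\<lambda>r. v (min r t) - v (min r s))"
    have w: "dominates w Y"
      using dominates_stopped_increment[OF v st(1,2)] by (simp add: w_def Y_def)
    obtain P where P: "\<And>n::nat. P n \<in> partitions t"
      "(\<lambda>n. integral_sum H Y (P n)) \<longlonglongrightarrow> stoch_integral H X t - stoch_integral H X s"
      using stoch_integral_increment[OF dominated_integrator[OF v] st(1,2)] unfolding Y_def by blast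
    have "norm (integral_sum H Y (P n)) \<le> C * (v t - v s)" for n
    proof -
      note g = partition_grid[OF P(1)[of n]]
      have "norm (H (left_pt (P n) r)) \<le> C" if "r \<in> P n" for r
      proof -
        have "0 \<le> r" "r \<le> T" using P(1)[of n] that st by (auto simp: partitions_def)
        then show ?thesis using left_pt_nonneg[OF g, of r] left_pt_le[OF g, of r] by (intro C) auto
      qed
      then have "(\<Sum>r\<in>P n. norm (H (left_pt (P n) r) (Y r - Y (left_pt (P n) r))))
          \<le> C * (w (Max (P n)) - w 0)"
        by (rule dominated_sum_bound[OF w g])
      also have "w (Max (P n)) - w 0 = v t - v s"
        using st by (simp add: partition_Max[OF P(1)[of n]] w_def)
      finally show ?thesis unfolding integral_sum_def by (rule order_trans[OF norm_sum])
    qed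
    then show ?thesis by (intro tendsto_upperbound[OF tendsto_norm[OF P(2)]]) auto
  qed
  have "(\<Sum>s\<in>Q. norm (stoch_integral H X s - stoch_integral H X (left_pt Q s))) \<le> C * (v T - v 0)"
    if Q: "Q \<in> partitions T" for Q
  proof -
    note g = partition_grid[OF Q]
    have "(\<Sum>s\<in>Q. norm (stoch_integral H X s - stoch_integral H X (left_pt Q s)))
        \<le> (\<Sum>s\<in>Q. C * (v s - v (left_pt Q s)))"
    proof (rule sum_mono)
      fix s assume "s \<in> Q"
      then have "0 \<le> s" "s \<le> T" using Q by (auto simp: partitions_def)
      then show "norm (stoch_integral H X s - stoch_integral H X (left_pt Q s)) \<le> C * (v s - v (left_pt Q s))"
        by (intro incr left_pt_nonneg[OF g] left_pt_le[OF g])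
    qed
    also have "\<dots> = C * (v T - v 0)"
      using sum_telescope[OF g, of v] by (simp add: partition_Max[OF Q] flip: sum_distrib_left)
    finally show ?thesis .
  qed
  then show "\<exists>C. \<forall>P\<in>partitions T.
      (\<Sum>s\<in>P. norm (stoch_integral H X s - stoch_integral H X (left_pt P s))) \<le> C" by blast
qed

lemma integral_sum_decomposition:
  assumes XMV: "\<And>t. 0 \<le> t \<Longrightarrow> X t = X 0 + M t + V t" and P: "P \<in> partitions t"
  shows "integral_sum H X P = integral_sum H M P + integral_sum H V P"
  unfolding integral_sum_def sum.distrib[symmetric]
proof (rule sum.cong)
  fix s assume "s \<in> P"
  then have s: "0 \<le> s" using P by (auto simp: partitions_def)
  have "X s - X (left_pt P s) = (M s - M (left_pt P s)) + (V s - V (left_pt P s))"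
    by (subst XMV[OF s], subst XMV[OF left_pt_nonneg[OF partition_grid[OF P] s]]) simp
  then show "H (left_pt P s) (X s - X (left_pt P s))
      = H (left_pt P s) (M s - M (left_pt P s)) + H (left_pt P s) (V s - V (left_pt P s))"
    by (simp add: blinfun.add_right)
qed simp

end

section \<open>Conditional expectations as orthogonal projections\<close>

text \<open>The classical argument: by the parallelogram identity a minimising sequence for the
  distance from \<open>x\<close> to \<open>S\<close> is Cauchy, and its limit is a nearest point.\<close>

lemma orthogonal_projection_exists:
  fixes S :: "'a::{real_inner,complete_space} set"
  assumes S: "subspace S" "closed S"
  obtains y where "y \<in> S" "x - y \<in> S\<^sup>\<bottom>"
proof -
  define d where "d = (INF y\<in>S. (norm (x - y))\<^sup>2)"
  have ne: "S \<noteq> {}" using S(1) subspace_0 by blast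
  have bdd: "bdd_below ((\<lambda>y. (norm (x - y))\<^sup>2) ` S)" by (intro bdd_belowI2[of _ 0]) simp
  have d: "d \<le> (norm (x - y))\<^sup>2" if "y \<in> S" for y
    unfolding d_def using bdd that by (rule cINF_lower)
  have "\<exists>y\<in>S. (norm (x - y))\<^sup>2 < d + inverse (real (Suc n))" for n
    using cINF_less_iff[OF ne bdd, of "d + inverse (real (Suc n))"] by (simp add: d_def)
  then obtain y where y: "\<And>n. y n \<in> S" "\<And>n. (norm (x - y n))\<^sup>2 < d + inverse (real (Suc n))"
    by metis
  have close: "(norm (y m - y n))\<^sup>2 \<le> 2 * (inverse (real (Suc m)) + inverse (real (Suc n)))" for m n
  proof -
    \<comment> \<open>The midpoint \<open>z\<close> lies in \<open>S\<close>, so it is no nearer to \<open>x\<close> than the infimum allows.\<close>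
    define z where "z = (1/2) *\<^sub>R (y m + y n)"
    have "z \<in> S" unfolding z_def by (intro subspace_scale subspace_add S(1) y)
    then have "d \<le> (norm (x - z))\<^sup>2" by (rule d)
    moreover have "(norm (y m - y n))\<^sup>2 + 4 * (norm (x - z))\<^sup>2 = 2 * (norm (x - y m))\<^sup>2 + 2 * (norm (x - y n))\<^sup>2"
      unfolding z_def
      by (simp add: power2_norm_eq_inner inner_diff inner_add algebra_simps inner_commute)
    ultimately show ?thesis using y(2)[of m] y(2)[of n] by argo
  qed
  have "Cauchy y"
  proof (rule metric_CauchyI)
    fix e :: real assume e: "0 < e"
    then have "0 < e\<^sup>2 / 4" by simp
    then obtain N where N: "inverse (real (Suc N)) < e\<^sup>2 / 4" using reals_Archimedean by blast
    have "dist (y m) (y n) < e" if "N \<le> m" "N \<le> n" for m n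
    proof -
      have "inverse (real (Suc m)) \<le> inverse (real (Suc N))" "inverse (real (Suc n)) \<le> inverse (real (Suc N))"
        using that by (auto intro!: le_imp_inverse_le)
      then have "(norm (y m - y n))\<^sup>2 < e\<^sup>2" using close[of m n] N by argo
      then show ?thesis using e by (simp add: dist_norm power_less_imp_less_base)
    qed
    then show "\<exists>N. \<forall>m\<ge>N. \<forall>n\<ge>N. dist (y m) (y n) < e" by blast
  qed
  then obtain l where l: "y \<longlonglongrightarrow> l" using Cauchy_convergent convergent_def by blast
  have lS: "l \<in> S" using S(2) y(1) l by (rule closed_sequentially)
  have "(norm (x - l))\<^sup>2 \<le> d"
  proof (rule tendsto_le[OF sequentially_bot])
    show "(\<lambda>n. (norm (x - y n))\<^sup>2) \<longlonglongrightarrow> (norm (x - l))\<^sup>2" by (intro tendsto_intros l)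
    show "(\<lambda>n. d + inverse (real (Suc n))) \<longlonglongrightarrow> d"
      using tendsto_add[OF tendsto_const LIMSEQ_inverse_real_of_nat, of d] by simp
    show "\<forall>\<^sub>F n in sequentially. (norm (x - y n))\<^sup>2 \<le> d + inverse (real (Suc n))"
      using y(2) by (simp add: less_imp_le)
  qed
  then have "(norm (x - l))\<^sup>2 \<le> (norm (x - z))\<^sup>2" if "z \<in> S" for z
    using d[OF that] by (rule order_trans)
  then have min: "norm (x - l) \<le> norm (x - z)" if "z \<in> S" for z
    using that norm_ge_zero by (metis power2_le_imp_le)
  have "inner z (x - l) = 0" if z: "z \<in> S" for z
  proof -
    have le: "inner (x - l) w \<le> 0" if "w \<in> S" for w
    proof -
      have "\<forall>z\<in>S. dist x l \<le> dist x z" using min by (simp add: dist_norm)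
      then show ?thesis
        using any_closest_point_dot[OF subspace_imp_convex[OF S(1)] S(2) lS subspace_add[OF S(1) lS that]]
        by simp
    qed
    have "inner (x - l) z = 0"
      using le[OF z] le[OF subspace_neg[OF S(1) z]] by (simp add: inner_minus_right)
    then show ?thesis by (simp only: inner_commute)
  qed
  then show thesis using that[OF lS] by (simp add: in_orthogonal_comp)
qed

lemma subspace_closure:
  fixes S :: "'a::real_normed_vector set"
  assumes "subspace S" shows "subspace (closure S)"
proof (rule subspaceI)
  show "0 \<in> closure S" using assms subspace_0 closure_subset by blast
next
  fix x y assume "x \<in> closure S" "y \<in> closure S"
  then obtain f g where "\<And>n::nat. f n \<in> S" "f \<longlonglongrightarrow> x" "\<And>n::nat. g n \<in> S" "g \<longlonglongrightarrow> y"
    unfolding closure_sequential by blast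
  then show "x + y \<in> closure S"
    unfolding closure_sequential using assms
    by (intro exI[of _ "\<lambda>n. f n + g n"]) (auto intro: subspace_add tendsto_add)
next
  fix c x assume "x \<in> closure S"
  then obtain f where "\<And>n::nat. f n \<in> S" "f \<longlonglongrightarrow> x"
    unfolding closure_sequential by blast
  then show "c *\<^sub>R x \<in> closure S"
    unfolding closure_sequential using assms
    by (intro exI[of _ "\<lambda>n. c *\<^sub>R f n"]) (auto intro: subspace_scale tendsto_scaleR)
qed

lemma subspace_L2:
  assumes N: "von_neumann_algebra N" "N \<subseteq> A" and \<iota>: "L2_completion A E \<iota>"
  shows "subspace (L2 \<iota> N)"
  unfolding L2_def
proof (rule subspace_closure, rule subspaceI)
  have \<iota>_add: "\<iota> (a + b) = \<iota> a + \<iota> b" if "a \<in> N" "b \<in> N" for a b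
    using \<iota> N(2) that unfolding L2_completion_def by blast
  have \<iota>_scale: "\<iota> (scaleC_op c a) = c *\<^sub>C \<iota> a" if "a \<in> N" for c a
    using \<iota> N(2) that unfolding L2_completion_def by blast
  have N_scale: "scaleC_op c a \<in> N" if "a \<in> N" for c a
    using N(1) that unfolding von_neumann_algebra_def by blast
  have scale: "c *\<^sub>R x \<in> \<iota> ` N" if x: "x \<in> \<iota> ` N" for c x
  proof -
    obtain a where a: "a \<in> N" "x = \<iota> a" using x by blast
    then have "c *\<^sub>R x = \<iota> (scaleC_op (of_real c) a)" by (simp add: \<iota>_scale scaleC_of_real)
    then show ?thesis using N_scale[OF a(1)] by blast
  qed
  have "id_blinfun \<in> N" using N(1) unfolding von_neumann_algebra_def by blast
  then have "0 *\<^sub>R \<iota> id_blinfun \<in> \<iota> ` N" by (intro scale imageI)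
  then show "0 \<in> \<iota> ` N" by simp
  show "x + y \<in> \<iota> ` N" if "x \<in> \<iota> ` N" "y \<in> \<iota> ` N" for x y
  proof -
    obtain a b where ab: "a \<in> N" "b \<in> N" "x = \<iota> a" "y = \<iota> b" using \<open>x \<in> \<iota> ` N\<close> \<open>y \<in> \<iota> ` N\<close> by blast
    then have "x + y = \<iota> (a + b)" by (simp add: \<iota>_add)
    moreover have "a + b \<in> N" using N(1) ab unfolding von_neumann_algebra_def by blast
    ultimately show ?thesis by blast
  qed
  show "c *\<^sub>R x \<in> \<iota> ` N" if "x \<in> \<iota> ` N" for c x using that by (rule scale)
qed

text \<open>Testing with the trace is complex orthogonality to \<open>\<iota> ` N\<close>; as \<open>\<iota> ` N\<close> is stable under
  multiplication by \<open>\<i>\<close>, it coincides with orthogonality for the real inner product.\<close>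

lemma trace_mult_eq_0_iff:
  assumes N: "von_neumann_algebra N" "N \<subseteq> A" and \<iota>: "L2_completion A E \<iota>"
  shows "(\<forall>b\<in>N. trace_mult \<iota> z b = 0) \<longleftrightarrow> z \<in> (L2 \<iota> N)\<^sup>\<bottom>"
proof
  assume tr: "\<forall>b\<in>N. trace_mult \<iota> z b = 0"
  have "inner (\<iota> b) z = 0" if b: "b \<in> N" for b
  proof -
    have "trace_mult \<iota> z (adj b) = 0" using tr von_neumann_algebra_adj(1)[OF N(1) b] by blast
    then have "cinner (\<iota> b) z = 0" by (simp add: trace_mult_def von_neumann_algebra_adj(2)[OF N(1) b])
    then show ?thesis by (simp add: inner_eq_Re_cinner)
  qed
  then have "closure (\<iota> ` N) \<subseteq> {w. inner w z = 0}"
    by (intro closure_minimal closed_Collect_eq continuous_intros) auto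
  then show "z \<in> (L2 \<iota> N)\<^sup>\<bottom>" by (auto simp: in_orthogonal_comp L2_def)
next
  assume z: "z \<in> (L2 \<iota> N)\<^sup>\<bottom>"
  have orth: "inner (\<iota> a) z = 0" if "a \<in> N" for a
    using z that closure_subset[of "\<iota> ` N"] by (auto simp: in_orthogonal_comp L2_def)
  show "\<forall>b\<in>N. trace_mult \<iota> z b = 0"
  proof
    fix b assume "b \<in> N"
    then have a: "adj b \<in> N" by (rule von_neumann_algebra_adj(1)[OF N(1)])
    then have ia: "scaleC_op \<i> (adj b) \<in> N" using N(1) unfolding von_neumann_algebra_def by blast
    have "\<iota> (scaleC_op \<i> (adj b)) = \<i> *\<^sub>C \<iota> (adj b)"
      using \<iota> a N(2) unfolding L2_completion_def by blast
    then have "inner z (\<i> *\<^sub>C \<iota> (adj b)) = 0" using orth[OF ia] by (simp add: inner_commute)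
    then have "Im (cinner z (\<iota> (adj b))) = 0" by (simp add: inner_eq_Re_cinner cinner_scaleC_right)
    moreover have "Re (cinner z (\<iota> (adj b))) = 0"
      using orth[OF a] by (simp add: inner_commute flip: inner_eq_Re_cinner)
    ultimately have "cinner z (\<iota> (adj b)) = 0" by (simp add: complex_eq_iff)
    then show "trace_mult \<iota> z b = 0"
      unfolding trace_mult_def by (subst cinner_commute) simp
  qed
qed

lemma trace_mult_diff: "trace_mult \<iota> (x - y) b = trace_mult \<iota> x b - trace_mult \<iota> y b"
proof -
  have "cinner (\<iota> (adj b)) (x - y + y) = cinner (\<iota> (adj b)) (x - y) + cinner (\<iota> (adj b)) y"
    by (rule cinner_add_right)
  then show ?thesis by (simp add: trace_mult_def)
qed

text \<open>The conditional expectation is defined by a description, whose uniqueness is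
  \<open>cond_exp_eqI\<close>. The existence of projections makes it meaningful at every \<open>x\<close>; without that,
  adaptedness of \<open>H\<close> would carry no information about where \<open>H t x\<close> lies.\<close>

lemma cond_exp_iff_orthogonal:
  assumes N: "von_neumann_algebra N" "N \<subseteq> A" and \<iota>: "L2_completion A E \<iota>"
  shows "cond_exp \<iota> N x = y \<longleftrightarrow> y \<in> L2 \<iota> N \<and> x - y \<in> (L2 \<iota> N)\<^sup>\<bottom>"
proof -
  have eq: "cond_exp \<iota> N x = y" if y: "y \<in> L2 \<iota> N" "x - y \<in> (L2 \<iota> N)\<^sup>\<bottom>" for y
  proof (rule cond_exp_eqI[OF N(1) y(1)])
    show "trace_mult \<iota> y b = trace_mult \<iota> x b" if "b \<in> N" for b
      using trace_mult_eq_0_iff[OF N \<iota>, of "x - y"] y(2) that by (simp add: trace_mult_diff)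
  qed
  obtain z where z: "z \<in> L2 \<iota> N" "x - z \<in> (L2 \<iota> N)\<^sup>\<bottom>"
    using orthogonal_projection_exists[OF subspace_L2[OF N \<iota>], of x] by (auto simp: L2_def)
  then show ?thesis using eq by metis
qed

lemma subspace_filtration_L2:
  assumes F: "filtration A F" and \<iota>: "L2_completion A E \<iota>"
  shows "subspace_filtration (\<lambda>t. L2 \<iota> (F t))"
  unfolding subspace_filtration_def
proof (intro conjI allI impI)
  fix t :: real assume "0 \<le> t"
  then show "subspace (L2 \<iota> (F t))"
    using F by (intro subspace_L2[OF _ _ \<iota>]) (auto simp: filtration_def)
  show "closed (L2 \<iota> (F t))" by (simp add: L2_def)
next
  fix s t :: real assume "0 \<le> s" "s \<le> t"
  then show "L2 \<iota> (F s) \<subseteq> L2 \<iota> (F t)"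
    using F unfolding L2_def filtration_def by (intro closure_mono image_mono) auto
qed

lemma L2_martingale_iff:
  assumes F: "filtration A F" and \<iota>: "L2_completion A E \<iota>"
  shows "L2_martingale \<iota> F X \<longleftrightarrow> martingale (\<lambda>t. L2 \<iota> (F t)) X"
proof -
  have "cond_exp \<iota> (F s) x = y \<longleftrightarrow> y \<in> L2 \<iota> (F s) \<and> x - y \<in> (L2 \<iota> (F s))\<^sup>\<bottom>" if "0 \<le> s" for s x y
    using F that by (intro cond_exp_iff_orthogonal[OF _ _ \<iota>]) (auto simp: filtration_def)
  then show ?thesis
    unfolding L2_martingale_def martingale_def adapted_process_def by auto
qed

text \<open>An \<open>x\<close> in \<open>L2 \<iota> (F u)\<close> is its own conditional expectation, hence so is \<open>H t x\<close>; an \<open>x\<close>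
  orthogonal to \<open>L2 \<iota> (F u)\<close> has conditional expectation \<open>0\<close>, hence so has \<open>H t x\<close>.\<close>

lemma adapted_map_intertwines:
  assumes F: "filtration A F" and \<iota>: "L2_completion A E\<^sub>A \<iota>"
    and G: "filtration B G" and \<kappa>: "L2_completion B E\<^sub>B \<kappa>"
    and H: "adapted_map \<iota> F \<kappa> G H" and t: "0 \<le> t"
  shows "intertwines (\<lambda>t. L2 \<iota> (F t)) (\<lambda>t. L2 \<kappa> (G t)) t (H t)"
  unfolding intertwines_def
proof (intro allI impI conjI subsetI; elim imageE)
  fix u x y assume u: "t \<le> u" and y: "y = H t x"
  have F': "von_neumann_algebra (F u)" "F u \<subseteq> A" and G': "von_neumann_algebra (G u)" "G u \<subseteq> B"
    using F G t u by (auto simp: filtration_def)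
  note condF = cond_exp_iff_orthogonal[OF F' \<iota>] and condG = cond_exp_iff_orthogonal[OF G' \<kappa>]
  have comm: "cond_exp \<kappa> (G u) y = H t (cond_exp \<iota> (F u) x)"
    using H t u unfolding adapted_map_def y by blast
  show "y \<in> L2 \<kappa> (G u)" if "x \<in> L2 \<iota> (F u)"
  proof -
    have "cond_exp \<iota> (F u) x = x"
      using condF that by (simp add: subspace_0 subspace_orthogonal_comp)
    then show ?thesis using comm condG y by metis
  qed
  show "y \<in> (L2 \<kappa> (G u))\<^sup>\<bottom>" if "x \<in> (L2 \<iota> (F u))\<^sup>\<bottom>"
  proof -
    have "cond_exp \<iota> (F u) x = 0"
      using condF that by (simp add: subspace_0 subspace_L2[OF F' \<iota>])
    then have "cond_exp \<kappa> (G u) y = 0" using comm by (simp add: blinfun.zero_right)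
    then show ?thesis using condG by (metis diff_zero)
  qed
qed


section \<open>Integrals of decomposable processes\<close>

theorem theorem1p7:
  fixes A :: "('h::complex_hilbert \<Rightarrow>\<^sub>L 'h) set" and E\<^sub>A :: "('h \<Rightarrow>\<^sub>L 'h) \<Rightarrow> complex"
    and F :: "real \<Rightarrow> ('h \<Rightarrow>\<^sub>L 'h) set" and \<iota> :: "('h \<Rightarrow>\<^sub>L 'h) \<Rightarrow> 'l::complex_hilbert"
    and B :: "('k::complex_hilbert \<Rightarrow>\<^sub>L 'k) set" and E\<^sub>B :: "('k \<Rightarrow>\<^sub>L 'k) \<Rightarrow> complex"
    and G :: "real \<Rightarrow> ('k \<Rightarrow>\<^sub>L 'k) set" and \<kappa> :: "('k \<Rightarrow>\<^sub>L 'k) \<Rightarrow> 'm::complex_hilbert"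
    and X :: "real \<Rightarrow> 'l" and H :: "real \<Rightarrow> 'l \<Rightarrow>\<^sub>L 'm"
  assumes "Wstar_probability_space A E\<^sub>A" "filtration A F" "L2_completion A E\<^sub>A \<iota>"
    and "Wstar_probability_space B E\<^sub>B" "filtration B G" "L2_completion B E\<^sub>B \<kappa>"
    and "L2_decomposable \<iota> F X"
    and "adapted_map \<iota> F \<kappa> G H" "continuous_on {0..} H"
  shows "(\<forall>t\<ge>0. (integral_sum H X \<longlongrightarrow> stoch_integral H X t) (mesh_to_0 t) \<and>
                 stoch_integral H X t \<in> L2 \<kappa> (G t)) \<and>
         L2_decomposable \<kappa> G (stoch_integral H X)"
proof -
  note F = assms(2,3) and G = assms(5,6)
  define K where "K = (\<lambda>t. L2 \<iota> (F t))"
  define L where "L = (\<lambda>t. L2 \<kappa> (G t))"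
  interpret adapted_integrand K L H
    unfolding K_def L_def
    by (intro adapted_integrand.intro subspace_filtration_L2[OF F] subspace_filtration_L2[OF G]
        adapted_map_intertwines[OF F G assms(8)] assms(9))
  obtain M V where M: "L2_martingale \<iota> F M" "continuous_on {0..} M"
    and V: "L2_FV \<iota> F V" "continuous_on {0..} V"
    and X: "\<And>t. 0 \<le> t \<Longrightarrow> X t = X 0 + M t + V t"
    using assms(7) unfolding L2_decomposable_def by blast
  have M': "martingale K M" using M(1) L2_martingale_iff[OF F] by (simp add: K_def)
  note M_int = martingale_integrator[OF K L M']
  obtain v where v: "dominates v V" using V(1) variation_dominates unfolding L2_FV_def by blast
  note V_int = dominated_integrator[OF v, of K L]
  let ?IM = "stoch_integral H M" and ?IV = "stoch_integral H V"
  have lim: "(integral_sum H X \<longlongrightarrow> ?IM t + ?IV t) (mesh_to_0 t)" if t: "0 \<le> t" for t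
  proof (rule Lim_transform_eventually)
    show "((\<lambda>P. integral_sum H M P + integral_sum H V P) \<longlongrightarrow> ?IM t + ?IV t) (mesh_to_0 t)"
      by (intro tendsto_add integral_sum_tendsto M_int V_int t)
    show "eventually (\<lambda>P. integral_sum H M P + integral_sum H V P = integral_sum H X P) (mesh_to_0 t)"
      by (rule eventually_mesh_to_0I[of 1]) (auto simp: integral_sum_decomposition[of X M V, OF X])
  qed
  have IX: "stoch_integral H X t = ?IM t + ?IV t" if "0 \<le> t" for t
    unfolding stoch_integral_def[of H X t]
    by (rule tendsto_Lim[OF mesh_to_0_nontrivial[OF that] lim[OF that]])
  have IM: "martingale L ?IM" by (rule stoch_integral_martingale[OF M'])
  have IV_mem: "?IV t \<in> L t" if "0 \<le> t" for t
    using V(1) that by (intro stoch_integral_mem[OF V_int]) (auto simp: L2_FV_def adapted_process_def K_def)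
  have IX_mem: "stoch_integral H X t \<in> L t" if t: "0 \<le> t" for t
    unfolding IX[OF t] using IM t
    by (intro subspace_add subspace_filtrationD(1)[OF L] IV_mem) (auto simp: martingale_def)
  have zero: "?IM 0 = 0" "?IV 0 = 0" using M_int V_int by (auto intro: stoch_integral_at_0)
  have "L2_decomposable \<kappa> G (stoch_integral H X)"
    unfolding L2_decomposable_def
  proof (intro conjI exI allI impI)
    show "adapted_process \<kappa> G (stoch_integral H X)"
      using IX_mem by (simp add: adapted_process_def L_def)
    show "L2_martingale \<kappa> G ?IM" using IM L2_martingale_iff[OF G] by (simp add: L_def)
    show "continuous_on {0..} ?IM" by (rule stoch_integral_continuous[OF M_int M(2)])
    show "L2_FV \<kappa> G ?IV"
      using IV_mem stoch_integral_bounded_variation[OF v]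
      by (simp add: L2_FV_def adapted_process_def L_def)
    show "continuous_on {0..} ?IV" by (rule stoch_integral_continuous[OF V_int V(2)])
    show "?IM 0 = 0" "?IV 0 = 0" by (rule zero)+
    show "stoch_integral H X t = stoch_integral H X 0 + ?IM t + ?IV t" if "0 \<le> t" for t
      using IX[OF that] IX[of 0] zero by simp
  qed
  then show ?thesis using lim IX IX_mem by (simp add: L_def)
qed

end
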